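(* In the hyperbolic plane $\mathbf{H}^2$, among all triangles with a fixed base (one side of prescribed length $z$) and fixed perimeter, the isosceles triangle, i.e. the one whose two sides other than the base have equal length, uniquely maximizes area.
   Context: $\mathbf{H}^2$ is the hyperbolic plane of curvature $-1$. Triangles are geodesic triangles, and uniqueness is up to congruence. *)

theory Defs
  imports "HOL-Analysis.Analysis"
begin

text \<open>
  The hyperbolic plane of curvature -1 in the Beltrami--Klein model: the open unit disc.
  The point \<open>x\<close> stands for the point \<open>(x, 1) / sqrt (1 - x \<bullet> x)\<close> of the sheet
  \<open>t\<^sup>2 - u \<bullet> u = 1, t > 0\<close> of the hyperboloid in Minkowski space. The distance
  between two points is the \<open>arcosh\<close> of the Minkowski product \<open>t t' - u \<bullet> u'\<close> of the
  points they stand for.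
\<close>

definition hplane :: "(real^2) set" where
  "hplane = ball 0 1"

definition hdist :: "real^2 \<Rightarrow> real^2 \<Rightarrow> real" where
  "hdist x y = arcosh ((1 - x \<bullet> y) / (sqrt (1 - x \<bullet> x) * sqrt (1 - y \<bullet> y)))"

definition hsegment :: "real^2 \<Rightarrow> real^2 \<Rightarrow> (real^2) set" where
  "hsegment a b = {p \<in> hplane. hdist a p + hdist p b = hdist a b}"

definition hconvex :: "(real^2) set \<Rightarrow> bool" where
  "hconvex S \<longleftrightarrow> S \<subseteq> hplane \<and> (\<forall>a\<in>S. \<forall>b\<in>S. hsegment a b \<subseteq> S)"

text \<open>
  The Riemannian area of a set. In the coordinates of the model the metric of curvature -1 is
  \<open>dx\<^sup>2 / (1 - r\<^sup>2) + (x \<bullet> dx)\<^sup>2 / (1 - r\<^sup>2)\<^sup>2\<close> with \<open>r = norm x\<close>; its determinant is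
  \<open>1 / (1 - r\<^sup>2)\<^sup>3\<close>, and the area density is the square root of that.
\<close>

definition harea :: "(real^2) set \<Rightarrow> real" where
  "harea S = (LINT x:S|lborel. 1 / sqrt (1 - x \<bullet> x) ^ 3)"

text \<open>Nondegenerate geodesic triangles, given by their vertices.\<close>

definition htriangle :: "real^2 \<Rightarrow> real^2 \<Rightarrow> real^2 \<Rightarrow> bool" where
  "htriangle A B C \<longleftrightarrow> A \<in> hplane \<and> B \<in> hplane \<and> C \<in> hplane \<and>
     A \<notin> hsegment B C \<and> B \<notin> hsegment C A \<and> C \<notin> hsegment A B"

definition hperimeter :: "real^2 \<Rightarrow> real^2 \<Rightarrow> real^2 \<Rightarrow> real" where
  "hperimeter A B C = hdist A B + hdist B C + hdist C A"

definition htriangle_area :: "real^2 \<Rightarrow> real^2 \<Rightarrow> real^2 \<Rightarrow> real" where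
  "htriangle_area A B C = harea (hconvex hull {A, B, C})"

definition hisometry :: "(real^2 \<Rightarrow> real^2) \<Rightarrow> bool" where
  "hisometry f \<longleftrightarrow> f ` hplane = hplane \<and>
     (\<forall>x\<in>hplane. \<forall>y\<in>hplane. hdist (f x) (f y) = hdist x y)"

definition hcongruent ::
    "real^2 \<Rightarrow> real^2 \<Rightarrow> real^2 \<Rightarrow> real^2 \<Rightarrow> real^2 \<Rightarrow> real^2 \<Rightarrow> bool" where
  "hcongruent A B C A' B' C' \<longleftrightarrow> (\<exists>f. hisometry f \<and> f A = A' \<and> f B = B' \<and> f C = C')"

text \<open>Triangles whose base \<open>AB\<close> has length \<open>z\<close> and whose perimeter is \<open>P\<close>.\<close>

definition base_perimeter_triangle :: "real \<Rightarrow> real \<Rightarrow> real^2 \<Rightarrow> real^2 \<Rightarrow> real^2 \<Rightarrow> bool" where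
  "base_perimeter_triangle z P A B C \<longleftrightarrow>
     htriangle A B C \<and> hdist A B = z \<and> hperimeter A B C = P"

end

theory Submission
  imports Defs
begin

text \<open>
  The convex cone over a triangle with vertices \<open>a\<close>, \<open>b\<close>, \<open>c\<close> on the hyperboloid is parametrised
  by \<open>u a + v b + c\<close> with \<open>u, v > 0\<close>. This pulls the area back to an elementary integral over the
  quadrant and gives, with \<open>\<alpha>\<close>, \<open>\<beta>\<close>, \<open>\<gamma>\<close> the hyperbolic cosines of the sides,
  \<open>tan (area / 2) = \<Delta> / (1 + \<alpha> + \<beta> + \<gamma>)\<close> where
  \<open>\<Delta>\<^sup>2 = 1 + 2 \<alpha> \<beta> \<gamma> - \<alpha>\<^sup>2 - \<beta>\<^sup>2 - \<gamma>\<^sup>2\<close> is the Gram determinant of \<open>a\<close>, \<open>b\<close>, \<open>c\<close>.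
  If the base \<open>z\<close> and the sum \<open>s\<close> of the other two sides are fixed and \<open>\<kappa>\<close> is the hyperbolic cosine
  of half their difference, then \<open>\<alpha> + \<beta> = 2 cosh (s/2) \<kappa>\<close> and
  \<open>\<Delta>\<^sup>2 = (cosh s - cosh z) (cosh z + 1 - 2 \<kappa>\<^sup>2)\<close>, so the area decreases strictly in \<open>\<kappa> \<ge> 1\<close>; and
  \<open>\<kappa> = 1\<close> exactly for the isosceles triangle, which is unique because three sides determine a
  triangle up to an isometry.
\<close>

subsection \<open>The hyperboloid model\<close>

text \<open>The sign makes the hyperboloid the upper sheet of \<open>mink u u = 1\<close>, so that
  the hyperbolic cosine of a distance is a value of the form itself.\<close>

definition mink :: "real^3 \<Rightarrow> real^3 \<Rightarrow> real" where
  "mink u v = u$3 * v$3 - u$1 * v$1 - u$2 * v$2"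

text \<open>The determinant with rows \<open>u\<close>, \<open>v\<close>, \<open>w\<close>, written
  out so that facts about it are polynomial identities.\<close>

definition triple :: "real^3 \<Rightarrow> real^3 \<Rightarrow> real^3 \<Rightarrow> real" where
  "triple u v w = u$1 * (v$2 * w$3 - v$3 * w$2) - u$2 * (v$1 * w$3 - v$3 * w$1)
     + u$3 * (v$1 * w$2 - v$2 * w$1)"

definition hyperboloid :: "(real^3) set" where
  "hyperboloid = {u. mink u u = 1 \<and> 0 < u$3}"

definition klein_lift :: "real^2 \<Rightarrow> real^3" where
  "klein_lift x = (1 / sqrt (1 - x \<bullet> x)) *\<^sub>R vector [x$1, x$2, 1]"

text \<open>Central projection to height 1. It is constant on rays, so it also serves for points of
  a cone that are not normalised to the hyperboloid.\<close>

definition klein_proj :: "real^3 \<Rightarrow> real^2" where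
  "klein_proj u = vector [u$1 / u$3, u$2 / u$3]"

lemma mink_commute: "mink u v = mink v u"
  by (simp add: mink_def mult.commute)

lemma mink_add_left: "mink (u + v) w = mink u w + mink v w"
  and mink_add_right: "mink w (u + v) = mink w u + mink w v"
  and mink_scale_left: "mink (r *\<^sub>R u) w = r * mink u w"
  and mink_scale_right: "mink w (r *\<^sub>R u) = r * mink w u"
  by (simp_all add: mink_def algebra_simps)

lemmas mink_simps = mink_add_left mink_add_right mink_scale_left mink_scale_right

lemma inner_real2: "x \<bullet> y = x$1 * y$1 + x$2 * y$2" for x y :: "real^2"
  by (simp add: inner_vec_def sum_2)

lemma vec3_eqI: "u$1 = v$1 \<Longrightarrow> u$2 = v$2 \<Longrightarrow> u$3 = v$3 \<Longrightarrow> u = v" for u v :: "real^3"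
  by (simp add: vec_eq_iff forall_3)

lemma hplane_iff: "x \<in> hplane \<longleftrightarrow> x \<bullet> x < 1"
  by (simp add: hplane_def norm_eq_sqrt_inner)

lemma klein_lift_nth:
  "klein_lift x $ 1 = x$1 / sqrt (1 - x \<bullet> x)"
  "klein_lift x $ 2 = x$2 / sqrt (1 - x \<bullet> x)"
  "klein_lift x $ 3 = 1 / sqrt (1 - x \<bullet> x)"
  by (simp_all add: klein_lift_def)

lemma klein_proj_nth:
  "klein_proj u $ 1 = u$1 / u$3" "klein_proj u $ 2 = u$2 / u$3"
  by (simp_all add: klein_proj_def)

lemma klein_lift_hyperboloid:
  assumes "x \<in> hplane" shows "klein_lift x \<in> hyperboloid"
proof -
  have p: "0 < 1 - x \<bullet> x" using assms by (simp add: hplane_iff)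
  have "mink (klein_lift x) (klein_lift x) = (1 - x \<bullet> x) / (sqrt (1 - x \<bullet> x))\<^sup>2"
    by (simp add: mink_def klein_lift_nth inner_real2 power2_eq_square diff_divide_distrib add_divide_distrib)
  then show ?thesis using p by (simp add: hyperboloid_def klein_lift_nth)
qed

lemma klein_proj_lift:
  assumes "x \<in> hplane" shows "klein_proj (klein_lift x) = x"
proof -
  have "0 < 1 - x \<bullet> x" using assms by (simp add: hplane_iff)
  then show ?thesis by (simp add: vec_eq_iff forall_2 klein_proj_nth klein_lift_nth)
qed

text \<open>Expresses the quantity underlying the area density of the disc through the Minkowski
  form.\<close>

lemma klein_proj_inner:
  assumes "u$3 \<noteq> 0"
  shows "1 - klein_proj u \<bullet> klein_proj u = mink u u / (u$3)\<^sup>2"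
  using assms by (simp add: inner_real2 klein_proj_nth mink_def power2_eq_square field_simps)

lemma klein_proj_hplane:
  assumes "0 < mink u u" "u$3 \<noteq> 0" shows "klein_proj u \<in> hplane"
proof -
  have "0 < 1 - klein_proj u \<bullet> klein_proj u"
    using assms by (simp add: klein_proj_inner)
  then show ?thesis by (simp add: hplane_iff)
qed

lemma klein_lift_proj:
  assumes "u \<in> hyperboloid" shows "klein_lift (klein_proj u) = u"
proof -
  have u: "mink u u = 1" "0 < u$3" using assms by (auto simp: hyperboloid_def)
  then have "sqrt (1 - klein_proj u \<bullet> klein_proj u) = 1 / u$3"
    by (simp add: klein_proj_inner real_sqrt_divide)
  then show ?thesis
    using u by (intro vec3_eqI) (simp_all add: klein_lift_nth klein_proj_nth)
qed

lemma hyperboloid_proj_hplane: "u \<in> hyperboloid \<Longrightarrow> klein_proj u \<in> hplane"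
  by (rule klein_proj_hplane) (auto simp: hyperboloid_def)

lemma hdist_mink: "hdist x y = arcosh (mink (klein_lift x) (klein_lift y))"
proof -
  have "mink (klein_lift x) (klein_lift y)
      = (1 - x \<bullet> y) / (sqrt (1 - x \<bullet> x) * sqrt (1 - y \<bullet> y))"
    by (simp add: mink_def klein_lift_nth inner_real2 diff_divide_distrib add_divide_distrib)
  then show ?thesis by (simp add: hdist_def)
qed

text \<open>Reversed Cauchy-Schwarz. The square of \<open>u$3 * v$3\<close> exceeds that of
  \<open>1 + d\<close> by the explicit sum of squares \<open>e\<close>, whose vanishing forces the
  first two coordinates, hence the points, to agree.\<close>

lemma mink_eq_1_or_greater:
  assumes "u \<in> hyperboloid" "v \<in> hyperboloid"
  shows "1 \<le> mink u v" and "mink u v = 1 \<longleftrightarrow> u = v"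
proof -
  have u: "(u$3)\<^sup>2 = 1 + (u$1)\<^sup>2 + (u$2)\<^sup>2" "0 < u$3"
    and v: "(v$3)\<^sup>2 = 1 + (v$1)\<^sup>2 + (v$2)\<^sup>2" "0 < v$3"
    using assms by (auto simp: hyperboloid_def mink_def power2_eq_square)
  define d where "d = u$1 * v$1 + u$2 * v$2"
  define e where "e = (u$1 - v$1)\<^sup>2 + (u$2 - v$2)\<^sup>2 + (u$1 * v$2 - u$2 * v$1)\<^sup>2"
  have eq: "(u$3 * v$3)\<^sup>2 = (1 + d)\<^sup>2 + e"
    unfolding power_mult_distrib u(1) v(1) d_def e_def by (simp add: power2_eq_square algebra_simps)
  have e0: "0 \<le> e" by (simp add: e_def)
  have m: "mink u v = u$3 * v$3 - d" by (simp add: mink_def d_def)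
  have "(1 + d)\<^sup>2 \<le> (u$3 * v$3)\<^sup>2" using eq e0 by linarith
  moreover have "0 \<le> u$3 * v$3" using u(2) v(2) by simp
  ultimately have "1 + d \<le> u$3 * v$3" by (rule power2_le_imp_le)
  then show "1 \<le> mink u v" by (simp add: m)
  show "mink u v = 1 \<longleftrightarrow> u = v"
  proof
    assume "mink u v = 1"
    then have "e = 0" using eq m by (simp add: algebra_simps)
    then have "(u$1 - v$1)\<^sup>2 = 0 \<and> (u$2 - v$2)\<^sup>2 = 0"
      unfolding e_def by (smt (verit) zero_le_power2)
    then have 12: "u$1 = v$1" "u$2 = v$2" by auto
    then have "(u$3)\<^sup>2 = (v$3)\<^sup>2" using u v by simp
    then have "u$3 = v$3" by (rule power2_eq_imp_eq[OF _ less_imp_le[OF u(2)] less_imp_le[OF v(2)]])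
    then show "u = v" using 12 by (intro vec3_eqI)
  next
    assume "u = v" then show "mink u v = 1" using assms by (simp add: hyperboloid_def)
  qed
qed

lemma cosh_hdist:
  assumes "x \<in> hplane" "y \<in> hplane"
  shows "cosh (hdist x y) = mink (klein_lift x) (klein_lift y)"
  using mink_eq_1_or_greater(1)[OF klein_lift_hyperboloid klein_lift_hyperboloid, OF assms]
  by (simp add: hdist_mink)

lemma hdist_nonneg:
  assumes "x \<in> hplane" "y \<in> hplane" shows "0 \<le> hdist x y"
  using mink_eq_1_or_greater(1)[OF klein_lift_hyperboloid klein_lift_hyperboloid, OF assms]
  by (simp add: hdist_mink)

lemma hdist_commute: "hdist x y = hdist y x"
  by (simp add: hdist_mink mink_commute)

lemma hdist_eq_0_iff:
  assumes "x \<in> hplane" "y \<in> hplane" shows "hdist x y = 0 \<longleftrightarrow> x = y"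
proof -
  have "hdist x y = 0 \<longleftrightarrow> klein_lift x = klein_lift y"
    using mink_eq_1_or_greater[OF klein_lift_hyperboloid klein_lift_hyperboloid, OF assms]
    by (simp add: hdist_mink)
  then show ?thesis using assms klein_proj_lift by metis
qed

lemma sinh_hdist:
  assumes "x \<in> hplane" "y \<in> hplane"
  shows "sinh (hdist x y) = sqrt ((mink (klein_lift x) (klein_lift y))\<^sup>2 - 1)"
  using mink_eq_1_or_greater(1)[OF klein_lift_hyperboloid klein_lift_hyperboloid, OF assms]
  by (simp add: hdist_mink sinh_arcosh_real)

text \<open>The Gram determinant of three vectors for the form \<open>mink\<close>, whose own determinant is \<open>1\<close>.\<close>

lemma triple_squared:
  "(triple u v w)\<^sup>2 = mink u u * mink v v * mink w w + 2 * mink v w * mink w u * mink u v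
     - mink u u * (mink v w)\<^sup>2 - mink v v * (mink w u)\<^sup>2 - mink w w * (mink u v)\<^sup>2"
  unfolding triple_def mink_def by algebra

lemma triple_hyperboloid:
  assumes "u \<in> hyperboloid" "v \<in> hyperboloid" "w \<in> hyperboloid"
  shows "(triple u v w)\<^sup>2 = 1 + 2 * mink v w * mink w u * mink u v
     - (mink v w)\<^sup>2 - (mink w u)\<^sup>2 - (mink u v)\<^sup>2"
  using assms triple_squared[of u v w] by (simp add: hyperboloid_def)

subsection \<open>Geodesic segments and convex hulls\<close>

text \<open>Twice the signed Euclidean area of the triangle with these vertices.\<close>

definition cross2 :: "real^2 \<Rightarrow> real^2 \<Rightarrow> real^2 \<Rightarrow> real" where
  "cross2 x y z = (y$1 - x$1) * (z$2 - x$2) - (y$2 - x$2) * (z$1 - x$1)"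

text \<open>Each lift is a positive multiple of \<open>(x, 1)\<close> and the determinant is
  multilinear. Hence linear dependence of the lifts is Euclidean collinearity in the disc.\<close>

lemma triple_klein_lift:
  assumes "x \<in> hplane" "y \<in> hplane" "z \<in> hplane"
  shows "triple (klein_lift x) (klein_lift y) (klein_lift z)
    = cross2 x y z / (sqrt (1 - x \<bullet> x) * sqrt (1 - y \<bullet> y) * sqrt (1 - z \<bullet> z))"
proof -
  have "triple (r *\<^sub>R u) (s *\<^sub>R v) (t *\<^sub>R w) = r * s * t * triple u v w" for r s t u v w
    by (simp add: triple_def algebra_simps)
  moreover have "triple (vector [x$1, x$2, 1]) (vector [y$1, y$2, 1]) (vector [z$1, z$2, 1])
      = cross2 x y z"
    by (simp add: triple_def cross2_def algebra_simps)
  ultimately show ?thesis by (simp add: klein_lift_def)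
qed

lemma triple_klein_lift_eq_0_iff:
  assumes "x \<in> hplane" "y \<in> hplane" "z \<in> hplane"
  shows "triple (klein_lift x) (klein_lift y) (klein_lift z) = 0 \<longleftrightarrow> cross2 x y z = 0"
  using assms by (simp add: triple_klein_lift hplane_iff)

lemma cross2_eq_0_iff_collinear: "cross2 x y z = 0 \<longleftrightarrow> collinear {x, y, z}"
proof -
  have "cross2 x y z = 0 \<longleftrightarrow> x = y \<or> (\<exists>k. z = k *\<^sub>R x + (1 - k) *\<^sub>R y)"
  proof
    assume c: "cross2 x y z = 0"
    show "x = y \<or> (\<exists>k. z = k *\<^sub>R x + (1 - k) *\<^sub>R y)"
    proof (cases "x$1 = y$1")
      case False
      \<comment> \<open>The parameter is read off a coordinate in which \<open>x\<close> and
        \<open>y\<close> differ; the other coordinate then follows from the vanishing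
        determinant.\<close>
      define k where "k = (z$1 - y$1) / (x$1 - y$1)"
      have k: "k * (x$1 - y$1) = z$1 - y$1" using False by (simp add: k_def)
      have "(x$1 - y$1) * (z$2 - y$2) = (x$2 - y$2) * (k * (x$1 - y$1))"
        using c unfolding k cross2_def by (simp add: algebra_simps)
      then have "(x$1 - y$1) * (z$2 - y$2 - k * (x$2 - y$2)) = 0"
        by (simp add: algebra_simps)
      then have "z$2 - y$2 = k * (x$2 - y$2)" using False by simp
      then have "z = k *\<^sub>R x + (1 - k) *\<^sub>R y"
        using k by (simp add: vec_eq_iff forall_2 algebra_simps)
      then show ?thesis by blast
    next
      case True
      show ?thesis
      proof (cases "x$2 = y$2")
        case False
        define k where "k = (z$2 - y$2) / (x$2 - y$2)"
        have k: "k * (x$2 - y$2) = z$2 - y$2" using False by (simp add: k_def)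
        have "(y$2 - x$2) * (z$1 - x$1) = 0" using c True by (simp add: cross2_def)
        then have "z$1 = x$1" using False by simp
        then have "z = k *\<^sub>R x + (1 - k) *\<^sub>R y"
          using k True by (simp add: vec_eq_iff forall_2 algebra_simps)
        then show ?thesis by blast
      qed (use True in \<open>simp add: vec_eq_iff forall_2\<close>)
    qed
  next
    assume "x = y \<or> (\<exists>k. z = k *\<^sub>R x + (1 - k) *\<^sub>R y)"
    then show "cross2 x y z = 0"
    proof
      assume "\<exists>k. z = k *\<^sub>R x + (1 - k) *\<^sub>R y"
      then obtain k where "z = k *\<^sub>R x + (1 - k) *\<^sub>R y" by blast
      then have "z$1 = k * x$1 + (1 - k) * y$1" "z$2 = k * x$2 + (1 - k) * y$2" by simp_all
      then show ?thesis unfolding cross2_def by algebra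
    qed (simp add: cross2_def)
  qed
  also have "\<dots> \<longleftrightarrow> collinear {x, z, y}" by (rule collinear_3_expand[symmetric])
  finally show ?thesis by (simp add: insert_commute)
qed

lemma mink_combination:
  assumes "u \<in> hyperboloid" "v \<in> hyperboloid" "s *\<^sub>R u + t *\<^sub>R v \<in> hyperboloid"
  defines "g \<equiv> mink u v"
  shows "mink u (s *\<^sub>R u + t *\<^sub>R v) = s + t * g"
    and "mink (s *\<^sub>R u + t *\<^sub>R v) v = s * g + t"
    and "s\<^sup>2 + t\<^sup>2 + 2 * s * t * g = 1"
proof -
  have 1: "mink u u = 1" "mink v v = 1" "mink v u = g"
    using assms by (simp_all add: hyperboloid_def mink_commute)
  then show "mink u (s *\<^sub>R u + t *\<^sub>R v) = s + t * g" "mink (s *\<^sub>R u + t *\<^sub>R v) v = s * g + t"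
    by (simp_all add: mink_simps g_def)
  have "mink (s *\<^sub>R u + t *\<^sub>R v) (s *\<^sub>R u + t *\<^sub>R v) = 1"
    using assms by (simp add: hyperboloid_def)
  then show "s\<^sup>2 + t\<^sup>2 + 2 * s * t * g = 1"
    using 1 by (simp add: mink_simps g_def power2_eq_square algebra_simps)
qed

text \<open>
  With \<open>g = cosh (hdist x y)\<close> one finds \<open>cosh (hdist x p + hdist p y) - g = (\<bar>s * t\<bar> - s * t) * (g\<^sup>2 - 1)\<close>.
\<close>

lemma hdist_additive_iff:
  assumes "x \<in> hplane" "y \<in> hplane" "p \<in> hplane" "x \<noteq> y"
    and p: "klein_lift p = s *\<^sub>R klein_lift x + t *\<^sub>R klein_lift y"
  shows "hdist x p + hdist p y = hdist x y \<longleftrightarrow> 0 \<le> s * t"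
proof -
  define g where "g = mink (klein_lift x) (klein_lift y)"
  note H = klein_lift_hyperboloid
  have g1: "1 < g"
    using mink_eq_1_or_greater[OF H H, OF assms(1,2)] assms klein_proj_lift
    unfolding g_def by (metis less_le)
  have "s *\<^sub>R klein_lift x + t *\<^sub>R klein_lift y \<in> hyperboloid"
    using H[OF assms(3)] p by simp
  note c = mink_combination[OF H[OF assms(1)] H[OF assms(2)] this, folded p g_def]
  \<comment> \<open>These are the squared hyperbolic sines of the two partial distances; taking
    roots is what brings in absolute values of \<open>s\<close> and \<open>t\<close>.\<close>
  have 1: "(s + t * g)\<^sup>2 - 1 = t\<^sup>2 * (g\<^sup>2 - 1)" "(s * g + t)\<^sup>2 - 1 = s\<^sup>2 * (g\<^sup>2 - 1)"
    using c(3) by algebra+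
  have "sinh (hdist x p) * sinh (hdist p y) = \<bar>t\<bar> * sqrt (g\<^sup>2 - 1) * (\<bar>s\<bar> * sqrt (g\<^sup>2 - 1))"
    using assms c by (simp add: sinh_hdist 1 real_sqrt_mult)
  also have "\<dots> = \<bar>s * t\<bar> * (g\<^sup>2 - 1)"
    using g1 by (simp add: abs_mult)
  finally have "cosh (hdist x p + hdist p y) = (s + t * g) * (s * g + t) + \<bar>s * t\<bar> * (g\<^sup>2 - 1)"
    using assms c by (simp add: cosh_add cosh_hdist)
  moreover have "(s + t * g) * (s * g + t) + s * t * (g\<^sup>2 - 1) = g"
    using c(3) by algebra
  ultimately have *: "cosh (hdist x p + hdist p y) - cosh (hdist x y) = (\<bar>s * t\<bar> - s * t) * (g\<^sup>2 - 1)"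
    using assms by (simp add: cosh_hdist g_def[symmetric] algebra_simps)
  have "1 < g\<^sup>2" using g1 by simp
  have "hdist x p + hdist p y = hdist x y \<longleftrightarrow> cosh (hdist x p + hdist p y) = cosh (hdist x y)"
    using hdist_nonneg assms by simp
  also have "\<dots> \<longleftrightarrow> \<bar>s * t\<bar> = s * t"
    using * \<open>1 < g\<^sup>2\<close> by (metis diff_gt_0_iff_gt eq_iff_diff_eq_0 less_irrefl mult_eq_0_iff)
  finally show ?thesis by (simp add: abs_eq_iff')
qed

text \<open>Rescaling to the hyperboloid multiplies affine weights by positive factors. Their signs
  survive, and the signs are all that \<open>hdist_additive_iff\<close> asks about.\<close>

lemma klein_lift_combination:
  assumes "x \<in> hplane" "y \<in> hplane" "p \<in> hplane" and p: "p = (1 - k) *\<^sub>R x + k *\<^sub>R y"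
  shows "klein_lift p = ((1 - k) * (sqrt (1 - x \<bullet> x) / sqrt (1 - p \<bullet> p))) *\<^sub>R klein_lift x
    + (k * (sqrt (1 - y \<bullet> y) / sqrt (1 - p \<bullet> p))) *\<^sub>R klein_lift y"
proof -
  have "0 < sqrt (1 - x \<bullet> x)" "0 < sqrt (1 - y \<bullet> y)" using assms by (simp_all add: hplane_iff)
  moreover have "p$1 = (1 - k) * x$1 + k * y$1" "p$2 = (1 - k) * x$2 + k * y$2" using p by simp_all
  ultimately show ?thesis
    by (intro vec3_eqI) (simp_all add: klein_lift_nth add_divide_distrib[symmetric])
qed

lemma closed_segment_hplane:
  "x \<in> hplane \<Longrightarrow> y \<in> hplane \<Longrightarrow> closed_segment x y \<subseteq> hplane"
  unfolding hplane_def by (simp add: closed_segment_subset)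

text \<open>Geodesics of the Klein model are chords. Additivity of distances first forces
  collinearity through the Gram determinant; the sign criterion then places the point between the
  ends.\<close>

lemma hsegment_eq_closed_segment:
  assumes xy: "x \<in> hplane" "y \<in> hplane"
  shows "hsegment x y = closed_segment x y"
proof (cases "x = y")
  case True
  have "hdist x p + hdist p x = hdist x x \<longleftrightarrow> p = x" if "p \<in> hplane" for p
    using hdist_eq_0_iff[OF xy(1) that] hdist_eq_0_iff[OF xy(1) xy(1)] by (auto simp: hdist_commute)
  then show ?thesis using xy True by (auto simp: hsegment_def)
next
  case False
  have iff: "hdist x p + hdist p y = hdist x y \<longleftrightarrow> 0 \<le> k * (1 - k)"
    if p: "p \<in> hplane" "p = (1 - k) *\<^sub>R x + k *\<^sub>R y" for p k
  proof -
    define a b where "a = sqrt (1 - x \<bullet> x) / sqrt (1 - p \<bullet> p)" and "b = sqrt (1 - y \<bullet> y) / sqrt (1 - p \<bullet> p)"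
    have "0 < a * b" using xy p by (simp add: a_def b_def hplane_iff)
    moreover have "(1 - k) * a * (k * b) = (a * b) * (k * (1 - k))" by simp
    moreover have "0 \<le> m * q \<longleftrightarrow> 0 \<le> q" if "0 < m" for m q :: real
      using that by (simp add: zero_le_mult_iff)
    ultimately have "0 \<le> (1 - k) * a * (k * b) \<longleftrightarrow> 0 \<le> k * (1 - k)"
      by presburger
    then show ?thesis
      using hdist_additive_iff[OF xy p(1) False klein_lift_combination[OF xy p]]
      by (simp add: a_def b_def)
  qed
  show ?thesis
  proof (intro equalityI subsetI)
    fix p assume "p \<in> closed_segment x y"
    then obtain k where k: "0 \<le> k" "k \<le> 1" "p = (1 - k) *\<^sub>R x + k *\<^sub>R y"
      by (auto simp: closed_segment_def)
    moreover have "p \<in> hplane" using \<open>p \<in> closed_segment x y\<close> closed_segment_hplane xy by blast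
    ultimately show "p \<in> hsegment x y"
      using iff by (simp add: hsegment_def)
  next
    fix p assume "p \<in> hsegment x y"
    then have p: "p \<in> hplane" and eq: "hdist x p + hdist p y = hdist x y"
      by (auto simp: hsegment_def)
    define \<alpha> \<beta> \<gamma> where "\<alpha> = cosh (hdist x p)" and "\<beta> = cosh (hdist p y)" and "\<gamma> = cosh (hdist x y)"
    \<comment> \<open>Squaring this addition formula eliminates the hyperbolic sines and leaves
      exactly the vanishing of the Gram determinant.\<close>
    have "\<gamma> = \<alpha> * \<beta> + sinh (hdist x p) * sinh (hdist p y)"
      by (simp add: \<gamma>_def \<alpha>_def \<beta>_def eq[symmetric] cosh_add)
    moreover have "(sinh (hdist x p))\<^sup>2 = \<alpha>\<^sup>2 - 1" "(sinh (hdist p y))\<^sup>2 = \<beta>\<^sup>2 - 1"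
      by (simp_all add: \<alpha>_def \<beta>_def sinh_square_eq)
    ultimately have "(\<gamma> - \<alpha> * \<beta>)\<^sup>2 = (\<alpha>\<^sup>2 - 1) * (\<beta>\<^sup>2 - 1)"
      by (simp add: power_mult_distrib)
    then have "1 + 2 * \<beta> * \<alpha> * \<gamma> - \<beta>\<^sup>2 - \<alpha>\<^sup>2 - \<gamma>\<^sup>2 = 0" by algebra
    then have "(triple (klein_lift x) (klein_lift y) (klein_lift p))\<^sup>2 = 0"
      using xy p unfolding \<alpha>_def \<beta>_def \<gamma>_def
      by (subst triple_hyperboloid) (simp_all add: klein_lift_hyperboloid cosh_hdist mink_commute)
    then have "collinear {x, y, p}"
      using xy p by (simp add: triple_klein_lift_eq_0_iff cross2_eq_0_iff_collinear)
    then have "collinear {x, p, y}" by (simp add: insert_commute)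
    then obtain k where k: "p = k *\<^sub>R x + (1 - k) *\<^sub>R y"
      using False by (auto simp: collinear_3_expand)
    then have pk: "p = (1 - (1 - k)) *\<^sub>R x + (1 - k) *\<^sub>R y" by simp
    then have "0 \<le> (1 - k) * (1 - (1 - k))" using iff[OF p pk] eq by simp
    then have "0 \<le> 1 - k" "1 - k \<le> 1"
      by (auto simp: zero_le_mult_iff)
    then show "p \<in> closed_segment x y"
      unfolding closed_segment_def using pk by blast
  qed
qed

lemma hconvex_iff: "hconvex S \<longleftrightarrow> S \<subseteq> hplane \<and> convex S"
proof -
  have "(\<forall>a\<in>S. \<forall>b\<in>S. hsegment a b \<subseteq> S) \<longleftrightarrow> convex S" if "S \<subseteq> hplane"
  proof -
    have "hsegment a b = closed_segment a b" if "a \<in> S" "b \<in> S" for a b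
      using that \<open>S \<subseteq> hplane\<close> by (intro hsegment_eq_closed_segment) auto
    then show ?thesis by (simp add: convex_contains_segment)
  qed
  then show ?thesis unfolding hconvex_def by blast
qed

text \<open>The disc is convex, so the Euclidean hull stays inside it and is hyperbolically convex.
  Conversely the hyperbolic hull intersects a smaller family of convex sets.\<close>

lemma hconvex_hull_eq:
  assumes "S \<subseteq> hplane" shows "hconvex hull S = convex hull S"
proof
  have "convex hull S \<subseteq> hplane"
    using assms by (intro hull_minimal) (simp_all add: hplane_def)
  then show "hconvex hull S \<subseteq> convex hull S"
    by (intro hull_minimal) (simp_all add: hconvex_iff hull_subset)
  show "convex hull S \<subseteq> hconvex hull S"
    unfolding hull_def by (intro Inter_anti_mono) (auto simp: hconvex_iff)
qed

text \<open>Three points are collinear exactly if one of them lies between the other two, and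
  betweenness is membership in a chord.\<close>

lemma htriangle_iff:
  "htriangle A B C \<longleftrightarrow> A \<in> hplane \<and> B \<in> hplane \<and> C \<in> hplane \<and> \<not> collinear {A, B, C}"
proof (cases "A \<in> hplane \<and> B \<in> hplane \<and> C \<in> hplane")
  case True
  then show ?thesis
    by (simp add: htriangle_def collinear_between_cases between_mem_segment hsegment_eq_closed_segment)
qed (auto simp: htriangle_def)

subsection \<open>An integral over the quadrant\<close>

text \<open>The form for open half-lines, as sides of the open quadrant; the endpoint is a null
  set.\<close>

lemma nn_integral_FTC_greaterThan:
  fixes f :: "real \<Rightarrow> real"
  assumes "f \<in> borel_measurable borel"
    and "\<And>x. a \<le> x \<Longrightarrow> DERIV F x :> f x"
    and "\<And>x. a \<le> x \<Longrightarrow> 0 \<le> f x"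
    and "(F \<longlongrightarrow> T) at_top"
  shows "(\<integral>\<^sup>+x. ennreal (f x) * indicator {a<..} x \<partial>lborel) = T - F a"
proof -
  have "AE x in lborel. x \<noteq> a" by (rule AE_lborel_singleton)
  then have "(\<integral>\<^sup>+x. ennreal (f x) * indicator {a<..} x \<partial>lborel)
      = (\<integral>\<^sup>+x. ennreal (f x) * indicator {a..} x \<partial>lborel)"
    by (intro nn_integral_cong_AE) (auto elim!: eventually_mono simp: indicator_def)
  then show ?thesis using nn_integral_FTC_atLeast[OF assms] by simp
qed

text \<open>For \<open>n\<close> different from \<open>m * m\<close> this is
  \<open>(u + m) / ((n - m * m) * r u)\<close> up to a constant. The present form stays valid when
  \<open>n = m * m\<close> and tends to 0 at infinity.\<close>

lemma quadratic_sqrt_antiderivative: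
  fixes m n u :: real
  assumes "0 < m" "0 < n" "0 \<le> u"
  defines "r \<equiv> \<lambda>u. sqrt (u\<^sup>2 + 2 * m * u + n)"
  shows "((\<lambda>u. - 1 / (r u * (r u + u + m))) has_real_derivative 1 / r u ^ 3) (at u)"
proof -
  have q: "0 < u\<^sup>2 + 2 * m * u + n" using assms by (simp add: add_nonneg_pos)
  then have r: "0 < r u" by (simp add: r_def)
  have s: "0 < r u + u + m" using r assms(1,3) by linarith
  have dr: "(r has_real_derivative (u + m) / r u) (at u)"
    unfolding r_def using q
    by (auto intro!: derivative_eq_intros simp: field_simps)
  have "((\<lambda>u. - 1 / (r u * (r u + u + m))) has_real_derivative
      ((u + m) / r u * (r u + u + m) + r u * ((u + m) / r u + 1)) / (r u * (r u + u + m))\<^sup>2) (at u)"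
  proof -
    have "((\<lambda>u. r u * (r u + u + m)) has_real_derivative
        (u + m) / r u * (r u + u + m) + r u * ((u + m) / r u + 1)) (at u)"
      by (auto intro!: derivative_eq_intros dr)
    from DERIV_minus[OF DERIV_inverse'[OF this]] r s show ?thesis
      by (simp add: divide_inverse power2_eq_square mult_ac)
  qed
  moreover have "((u + m) / r u * (r u + u + m) + r u * ((u + m) / r u + 1)) / (r u * (r u + u + m))\<^sup>2
      = 1 / r u ^ 3"
  proof -
    have "(u + m) / r u * (r u + u + m) + r u * ((u + m) / r u + 1) = (r u + u + m)\<^sup>2 / r u"
      using r by (simp add: field_simps power2_eq_square)
    then show ?thesis
      using r s by (simp add: power_mult_distrib power2_eq_square power3_eq_cube)
  qed
  ultimately show ?thesis by simp
qed

lemma nn_integral_quadratic_sqrt: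
  fixes m n :: real
  assumes "0 < m" "0 < n"
  shows "(\<integral>\<^sup>+u. ennreal (1 / sqrt (u\<^sup>2 + 2 * m * u + n) ^ 3) * indicator {0<..} u \<partial>lborel)
    = ennreal (1 / (sqrt n * (sqrt n + m)))"
proof -
  define r where "r u = sqrt (u\<^sup>2 + 2 * m * u + n)" for u
  have "((\<lambda>u. - 1 / (r u * (r u + u + m))) \<longlongrightarrow> 0) at_top"
  proof -
    have "filterlim (\<lambda>u. sqrt n * u) at_top at_top"
      using assms by (intro filterlim_tendsto_pos_mult_at_top[OF tendsto_const]) (auto simp: filterlim_ident)
    moreover have "eventually (\<lambda>u. sqrt n * u \<le> r u * (r u + u + m)) at_top"
    proof (rule eventually_mono[OF eventually_ge_at_top[of 0]])
      fix u :: real assume "0 \<le> u"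
      then have "sqrt n \<le> r u" using assms by (simp add: r_def)
      moreover have "0 \<le> sqrt n" using assms by simp
      ultimately show "sqrt n * u \<le> r u * (r u + u + m)"
        using assms \<open>0 \<le> u\<close> by (intro mult_mono) linarith+
    qed
    ultimately have "filterlim (\<lambda>u. r u * (r u + u + m)) at_top at_top"
      by (rule filterlim_at_top_mono)
    then have "((\<lambda>u. - inverse (r u * (r u + u + m))) \<longlongrightarrow> - 0) at_top"
      by (intro tendsto_minus tendsto_inverse_0_at_top)
    then show ?thesis by (simp add: divide_inverse)
  qed
  then have "(\<integral>\<^sup>+u. ennreal (1 / r u ^ 3) * indicator {0<..} u \<partial>lborel)
      = 0 - (- 1 / (r 0 * (r 0 + 0 + m)))"
  proof (intro nn_integral_FTC_greaterThan)
    show "(\<lambda>u. 1 / r u ^ 3) \<in> borel_measurable borel" unfolding r_def by measurable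
    show "((\<lambda>u. - 1 / (r u * (r u + u + m))) has_real_derivative 1 / r u ^ 3) (at u)" if "0 \<le> u" for u
      using quadratic_sqrt_antiderivative[OF assms that] by (simp add: r_def[abs_def])
    show "0 \<le> 1 / r u ^ 3" if "0 \<le> u" for u
      using assms that by (simp add: r_def)
  qed
  then show ?thesis by (simp add: r_def)
qed

text \<open>Substituting \<open>w = v + sqrt (v\<^sup>2 + 2 * \<alpha> * v + 1)\<close> makes the integrand rational.\<close>

lemma outer_antiderivative:
  fixes \<alpha> \<beta> \<gamma> D v :: real
  assumes pos: "0 < \<alpha>" "0 < \<beta>" "0 < \<gamma>" "0 < D" "0 \<le> v"
    and D: "D\<^sup>2 = 1 + 2 * \<alpha> * \<beta> * \<gamma> - \<alpha>\<^sup>2 - \<beta>\<^sup>2 - \<gamma>\<^sup>2"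
  defines "r \<equiv> \<lambda>v. sqrt (v\<^sup>2 + 2 * \<alpha> * v + 1)"
  shows "((\<lambda>v. 2 * arctan (((\<gamma> + 1) * (v + r v) + \<alpha> + \<beta>) / D)) has_real_derivative
    D * (1 / (r v * (r v + (\<gamma> * v + \<beta>))))) (at v)"
proof -
  have q: "0 < v\<^sup>2 + 2 * \<alpha> * v + 1" using assms by (simp add: add_nonneg_pos)
  then have r: "0 < r v" and rr: "(r v)\<^sup>2 = v\<^sup>2 + 2 * \<alpha> * v + 1" by (simp_all add: r_def)
  define N where "N = (\<gamma> + 1) * (v + r v) + \<alpha> + \<beta>"
  have s: "0 < r v + (\<gamma> * v + \<beta>)" using r pos by (simp add: add_pos_nonneg add_nonneg_pos)
  have dr: "(r has_real_derivative (v + \<alpha>) / r v) (at v)"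
    unfolding r_def using q by (auto intro!: derivative_eq_intros simp: field_simps)
  have "((\<lambda>v. 2 * arctan (((\<gamma> + 1) * (v + r v) + \<alpha> + \<beta>) / D)) has_real_derivative
      2 * (((\<gamma> + 1) * (1 + (v + \<alpha>) / r v)) / D) / (1 + (N / D)\<^sup>2)) (at v)"
  proof -
    have "((\<lambda>v. ((\<gamma> + 1) * (v + r v) + \<alpha> + \<beta>) / D) has_real_derivative
        ((\<gamma> + 1) * (1 + (v + \<alpha>) / r v)) / D) (at v)"
      using pos by (auto intro!: derivative_eq_intros dr)
    from DERIV_cmult[OF DERIV_chain2[OF DERIV_arctan this], of 2] show ?thesis
      by (simp add: N_def divide_inverse mult_ac del: distrib_left_numeral distrib_right_numeral)
  qed
  moreover have "2 * (((\<gamma> + 1) * (1 + (v + \<alpha>) / r v)) / D) / (1 + (N / D)\<^sup>2)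
      = D * (1 / (r v * (r v + (\<gamma> * v + \<beta>))))"
  proof -
    \<comment> \<open>The choice of \<open>D\<close> enters here: it makes the denominator produced
      by arctan factor and cancel against the derivative of \<open>N\<close>.\<close>
    have "2 * (\<gamma> + 1) * (r v + v + \<alpha>) * (r v + (\<gamma> * v + \<beta>)) = D\<^sup>2 + N\<^sup>2"
      using rr D unfolding N_def by algebra
    moreover have "0 < D\<^sup>2 + N\<^sup>2" using pos by (simp add: add_pos_nonneg)
    moreover have "2 * (((\<gamma> + 1) * (1 + (v + \<alpha>) / r v)) / D) / (1 + (N / D)\<^sup>2)
        = D * (2 * (\<gamma> + 1) * (r v + v + \<alpha>)) / (r v * (D\<^sup>2 + N\<^sup>2))"
    proof -
      have "1 + (N / D)\<^sup>2 = (D\<^sup>2 + N\<^sup>2) / D\<^sup>2" using pos by (simp add: power_divide add_divide_distrib)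
      moreover have "1 + (v + \<alpha>) / r v = (r v + v + \<alpha>) / r v" using r by (simp add: add_divide_distrib)
      ultimately show ?thesis using pos by (simp add: power2_eq_square)
    qed
    ultimately show ?thesis
      using r s pos by (simp add: frac_eq_eq)
  qed
  ultimately show ?thesis by simp
qed

text \<open>For fixed \<open>v\<close> the radicand is a quadratic in \<open>u\<close>, which the
  previous integral settles; what remains in \<open>v\<close> is the derivative of an arctan that
  tends to a right angle at infinity.\<close>

lemma nn_integral_quadrant:
  fixes \<alpha> \<beta> \<gamma> D :: real
  assumes pos: "0 < \<alpha>" "0 < \<beta>" "0 < \<gamma>" "0 < D"
    and D: "D\<^sup>2 = 1 + 2 * \<alpha> * \<beta> * \<gamma> - \<alpha>\<^sup>2 - \<beta>\<^sup>2 - \<gamma>\<^sup>2"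
  shows "(\<integral>\<^sup>+v. (\<integral>\<^sup>+u. ennreal (D / sqrt (u\<^sup>2 + v\<^sup>2 + 1 + 2 * u * v * \<gamma> + 2 * u * \<beta> + 2 * v * \<alpha>) ^ 3)
      * indicator {0<..} u \<partial>lborel) * indicator {0<..} v \<partial>lborel)
    = ennreal (pi - 2 * arctan ((1 + \<alpha> + \<beta> + \<gamma>) / D))"
proof -
  define r where "r v = sqrt (v\<^sup>2 + 2 * \<alpha> * v + 1)" for v
  have inner: "(\<integral>\<^sup>+u. ennreal (D / sqrt (u\<^sup>2 + v\<^sup>2 + 1 + 2 * u * v * \<gamma> + 2 * u * \<beta> + 2 * v * \<alpha>) ^ 3)
      * indicator {0<..} u \<partial>lborel) = ennreal (D * (1 / (r v * (r v + (\<gamma> * v + \<beta>)))))"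
    if v: "0 < v" for v
  proof -
    define m n where "m = \<gamma> * v + \<beta>" and "n = v\<^sup>2 + 2 * \<alpha> * v + 1"
    have mn: "0 < m" "0 < n" using pos v by (simp_all add: m_def n_def add_pos_pos)
    have eq: "u\<^sup>2 + v\<^sup>2 + 1 + 2 * u * v * \<gamma> + 2 * u * \<beta> + 2 * v * \<alpha> = u\<^sup>2 + 2 * m * u + n" for u
      by (simp add: m_def n_def algebra_simps)
    have "(\<integral>\<^sup>+u. ennreal (D / sqrt (u\<^sup>2 + 2 * m * u + n) ^ 3) * indicator {0<..} u \<partial>lborel)
        = (\<integral>\<^sup>+u. ennreal D * (ennreal (1 / sqrt (u\<^sup>2 + 2 * m * u + n) ^ 3) * indicator {0<..} u) \<partial>lborel)"
      using pos by (intro nn_integral_cong) (simp add: ennreal_mult'[symmetric] mult.assoc[symmetric])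
    also have "\<dots> = ennreal D * (\<integral>\<^sup>+u. ennreal (1 / sqrt (u\<^sup>2 + 2 * m * u + n) ^ 3) * indicator {0<..} u \<partial>lborel)"
      by (rule nn_integral_cmult) measurable
    also have "\<dots> = ennreal (D * (1 / (sqrt n * (sqrt n + m))))"
      using pos mn by (simp add: nn_integral_quadratic_sqrt ennreal_mult'[symmetric])
    finally show ?thesis by (simp add: eq r_def n_def m_def)
  qed
  have "(\<integral>\<^sup>+v. (\<integral>\<^sup>+u. ennreal (D / sqrt (u\<^sup>2 + v\<^sup>2 + 1 + 2 * u * v * \<gamma> + 2 * u * \<beta> + 2 * v * \<alpha>) ^ 3)
      * indicator {0<..} u \<partial>lborel) * indicator {0<..} v \<partial>lborel)
      = (\<integral>\<^sup>+v. ennreal (D * (1 / (r v * (r v + (\<gamma> * v + \<beta>))))) * indicator {0<..} v \<partial>lborel)"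
    by (intro nn_integral_cong) (simp add: inner split: split_indicator)
  also have "\<dots> = pi - 2 * arctan (((\<gamma> + 1) * (0 + r 0) + \<alpha> + \<beta>) / D)"
  proof (intro nn_integral_FTC_greaterThan)
    show "(\<lambda>v. D * (1 / (r v * (r v + (\<gamma> * v + \<beta>))))) \<in> borel_measurable borel"
      unfolding r_def by measurable
    show "((\<lambda>v. 2 * arctan (((\<gamma> + 1) * (v + r v) + \<alpha> + \<beta>) / D)) has_real_derivative
        D * (1 / (r v * (r v + (\<gamma> * v + \<beta>))))) (at v)" if "0 \<le> v" for v
      using outer_antiderivative[OF pos that D] by (simp add: r_def[abs_def])
    show "0 \<le> D * (1 / (r v * (r v + (\<gamma> * v + \<beta>))))" if "0 \<le> v" for v
      using pos that by (simp add: r_def)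
    have "eventually (\<lambda>v. (1 / D) * v \<le> ((\<gamma> + 1) * (v + r v) + \<alpha> + \<beta>) / D) at_top"
    proof (rule eventually_mono[OF eventually_ge_at_top[of 0]])
      fix v :: real assume v: "0 \<le> v"
      then have "0 \<le> r v" "0 \<le> \<gamma> * (v + r v)" using pos by (simp_all add: r_def)
      then have "v \<le> (\<gamma> + 1) * (v + r v) + \<alpha> + \<beta>" using pos by (simp add: algebra_simps)
      then show "(1 / D) * v \<le> ((\<gamma> + 1) * (v + r v) + \<alpha> + \<beta>) / D"
        using pos by (simp add: divide_right_mono)
    qed
    moreover have "filterlim (\<lambda>v. (1 / D) * v) at_top at_top"
      using pos by (intro filterlim_tendsto_pos_mult_at_top[OF tendsto_const]) (auto simp: filterlim_ident)
    ultimately have "filterlim (\<lambda>v. ((\<gamma> + 1) * (v + r v) + \<alpha> + \<beta>) / D) at_top at_top"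
      by (rule filterlim_at_top_mono[rotated])
    then have "((\<lambda>v. arctan (((\<gamma> + 1) * (v + r v) + \<alpha> + \<beta>) / D)) \<longlongrightarrow> pi / 2) at_top"
      by (rule filterlim_compose[OF tendsto_arctan_at_top])
    then have "((\<lambda>v. 2 * arctan (((\<gamma> + 1) * (v + r v) + \<alpha> + \<beta>) / D)) \<longlongrightarrow> 2 * (pi / 2)) at_top"
      by (intro tendsto_mult tendsto_const)
    then show "((\<lambda>v. 2 * arctan (((\<gamma> + 1) * (v + r v) + \<alpha> + \<beta>) / D)) \<longlongrightarrow> pi) at_top"
      by simp
  qed
  also have "((\<gamma> + 1) * (0 + r 0) + \<alpha> + \<beta>) = 1 + \<alpha> + \<beta> + \<gamma>" by (simp add: r_def)
  finally show ?thesis .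
qed

section \<open>Lebesgue measure on the plane as a product measure\<close>

lemma vector_2_axis: "vector [s, t] = s *\<^sub>R axis 1 1 + t *\<^sub>R (axis 2 1 :: real^2)"
  by (simp add: vec_eq_iff forall_2 axis_def)

lemma vector_2_borel_measurable:
  "(\<lambda>(u, v). vector [u, v] :: real^2) \<in> borel_measurable (lborel \<Otimes>\<^sub>M lborel)"
proof -
  have "continuous_on UNIV
      (\<lambda>p :: real \<times> real. fst p *\<^sub>R axis 1 1 + snd p *\<^sub>R (axis 2 1 :: real^2))"
    by (intro continuous_intros)
  then show ?thesis
    by (simp add: borel_measurable_continuous_onI lborel_prod case_prod_beta' vector_2_axis)
qed

text \<open>Lebesgue measure is determined by its values on boxes, and a box pulls back to a product
  of two intervals. This gives access to iterated integrals.\<close>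

lemma lborel_real2_eq_distr:
  "(lborel :: (real^2) measure) = distr (lborel \<Otimes>\<^sub>M lborel) borel (\<lambda>(u, v). vector [u, v])"
proof (rule lborel_eqI)
  fix l u :: "real^2"
  assume le: "\<And>b. b \<in> Basis \<Longrightarrow> l \<bullet> b \<le> u \<bullet> b"
  have 12: "l$1 \<le> u$1" "l$2 \<le> u$2"
    using le[of "axis 1 1"] le[of "axis 2 1"] by (simp_all add: inner_axis axis_in_Basis_iff)
  have "(\<lambda>(u, v). vector [u, v]) -` box l u \<inter> space (lborel \<Otimes>\<^sub>M lborel)
      = {l$1<..<u$1} \<times> {l$2<..<u$2}"
    by (auto simp: mem_box_cart forall_2 space_pair_measure)
  then have "emeasure (distr (lborel \<Otimes>\<^sub>M lborel) borel (\<lambda>(u, v). vector [u, v])) (box l u)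
      = ennreal (u$1 - l$1) * ennreal (u$2 - l$2)"
    using vector_2_borel_measurable 12 by (simp add: emeasure_distr lborel.emeasure_pair_measure_Times)
  also have "\<dots> = ennreal ((u$1 - l$1) * (u$2 - l$2))"
    using 12 by (simp add: ennreal_mult)
  also have "(u$1 - l$1) * (u$2 - l$2) = (\<Prod>i\<in>UNIV. (u - l)$i)"
    by (simp add: UNIV_2)
  also have "\<dots> = (\<Prod>b\<in>Basis. (u - l) \<bullet> b)"
    by (simp add: Basis_vec_def UNION_singleton_eq_range prod.reindex inj_on_def axis_eq_axis inner_axis)
  finally show "emeasure (distr (lborel \<Otimes>\<^sub>M lborel) borel (\<lambda>(u, v). vector [u, v])) (box l u)
      = ennreal (\<Prod>b\<in>Basis. (u - l) \<bullet> b)" .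
qed simp

subsection \<open>The area of a triangle\<close>

text \<open>The vector-valued theorem for \<open>real^1\<close>, whose integrals are those of the
  single coordinate.\<close>

lemma has_absolute_integral_change_of_variables_scalar:
  fixes f :: "real^'m::{finite,wellorder} \<Rightarrow> real" and g :: "real^'m::_ \<Rightarrow> real^'m::_"
  assumes "S \<in> sets lebesgue"
    and "\<And>x. x \<in> S \<Longrightarrow> (g has_derivative g' x) (at x within S)"
    and "inj_on g S"
  shows "(\<lambda>x. \<bar>det (matrix (g' x))\<bar> * f (g x)) absolutely_integrable_on S \<and>
           integral S (\<lambda>x. \<bar>det (matrix (g' x))\<bar> * f (g x)) = b
     \<longleftrightarrow> f absolutely_integrable_on (g ` S) \<and> integral (g ` S) f = b"
proof -
  have "(\<lambda>x. \<bar>det (matrix (g' x))\<bar> *\<^sub>R vec (f (g x)) :: real^1) absolutely_integrable_on S \<and>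
           integral S (\<lambda>x. \<bar>det (matrix (g' x))\<bar> *\<^sub>R vec (f (g x))) = (vec b :: real^1)
         \<longleftrightarrow> (\<lambda>x. vec (f x) :: real^1) absolutely_integrable_on (g ` S) \<and>
           integral (g ` S) (\<lambda>x. vec (f x)) = (vec b :: real^1)"
    by (rule has_absolute_integral_change_of_variables[OF assms])
  then show ?thesis
    by (simp add: absolutely_integrable_on_1_iff integral_on_1_eq)
qed

section \<open>Parametrising a triangle by the quadrant\<close>

definition quadrant :: "(real^2) set" where
  "quadrant = {x. 0 < x$1 \<and> 0 < x$2}"

text \<open>Fixing the weight of \<open>c\<close> at 1 picks one representative on each ray of the
  open cone.\<close>

definition cone_point :: "real^3 \<Rightarrow> real^3 \<Rightarrow> real^3 \<Rightarrow> real^2 \<Rightarrow> real^3" where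
  "cone_point a b c x = x$1 *\<^sub>R a + x$2 *\<^sub>R b + c"

lemma quadrant_borel: "quadrant \<in> sets borel"
proof -
  have "quadrant = {x. 0 < x$1} \<inter> {x. 0 < x$2}" by (auto simp: quadrant_def)
  moreover have "open {x :: real^2. 0 < x$i}" for i by (intro open_Collect_less continuous_intros)
  ultimately show ?thesis by (metis open_Int borel_open)
qed

text \<open>Products of points of the sheet are at least 1, so every term of the expanded form is
  positive. The expansion is the radicand of the quadrant integral.\<close>

lemma cone_point_hyperboloid:
  assumes "a \<in> hyperboloid" "b \<in> hyperboloid" "c \<in> hyperboloid" "x \<in> quadrant"
  shows "0 < cone_point a b c x $ 3"
    and "0 < mink (cone_point a b c x) (cone_point a b c x)"
    and "mink (cone_point a b c x) (cone_point a b c x) = (x$1)\<^sup>2 + (x$2)\<^sup>2 + 1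
      + 2 * x$1 * x$2 * mink a b + 2 * x$1 * mink c a + 2 * x$2 * mink b c"
proof -
  have x: "0 < x$1" "0 < x$2" using assms by (auto simp: quadrant_def)
  show "0 < cone_point a b c x $ 3"
    using assms x by (simp add: cone_point_def hyperboloid_def add_pos_pos)
  show eq: "mink (cone_point a b c x) (cone_point a b c x) = (x$1)\<^sup>2 + (x$2)\<^sup>2 + 1
      + 2 * x$1 * x$2 * mink a b + 2 * x$1 * mink c a + 2 * x$2 * mink b c"
    using assms mink_commute[of b a] mink_commute[of c b] mink_commute[of a c]
    by (simp add: cone_point_def hyperboloid_def mink_simps power2_eq_square algebra_simps)
  have "0 < mink a b" "0 < mink c a" "0 < mink b c"
    using mink_eq_1_or_greater(1) assms(1-3) by (meson less_le_trans zero_less_one)+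
  then show "0 < mink (cone_point a b c x) (cone_point a b c x)"
    unfolding eq using x by (intro add_pos_pos mult_pos_pos) auto
qed

lemma cone_map_has_derivative:
  fixes a b c x
  defines "X \<equiv> cone_point a b c x"
  assumes "X $ 3 \<noteq> 0"
  defines "d \<equiv> \<lambda>i (h :: real^2). ((h$1 * a$i + h$2 * b$i) * X$3 - X$i * (h$1 * a$3 + h$2 * b$3)) / (X$3)\<^sup>2"
  shows "((\<lambda>x. klein_proj (cone_point a b c x)) has_derivative (\<lambda>h. vector [d 1 h, d 2 h])) (at x within S)"
    and "det (matrix (\<lambda>h. vector [d 1 h, d 2 h] :: real^2)) = triple a b c / (X$3) ^ 3"
proof -
  have nth: "((\<lambda>x. cone_point a b c x $ i) has_derivative (\<lambda>h. h$1 * a$i + h$2 * b$i)) (at x within S)" for i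
    unfolding cone_point_def
    by (auto intro!: derivative_eq_intros bounded_linear.has_derivative[OF bounded_linear_vec_nth])
  have div: "((\<lambda>x. cone_point a b c x $ i / cone_point a b c x $ 3) has_derivative d i) (at x within S)" for i
    using has_derivative_divide'[OF nth nth, of 3 i] assms(2)
    by (simp add: X_def d_def power2_eq_square)
  show "((\<lambda>x. klein_proj (cone_point a b c x)) has_derivative (\<lambda>h. vector [d 1 h, d 2 h])) (at x within S)"
    unfolding klein_proj_def vector_2_axis
    by (intro has_derivative_add has_derivative_scaleR_left div)
  have "det (matrix (\<lambda>h. vector [d 1 h, d 2 h] :: real^2))
      = (a$1 * X$3 - X$1 * a$3) / (X$3)\<^sup>2 * ((b$2 * X$3 - X$2 * b$3) / (X$3)\<^sup>2)
        - (b$1 * X$3 - X$1 * b$3) / (X$3)\<^sup>2 * ((a$2 * X$3 - X$2 * a$3) / (X$3)\<^sup>2)"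
    by (simp add: det_2 matrix_def d_def axis_def)
  also have "\<dots> = ((a$1 * X$3 - X$1 * a$3) * (b$2 * X$3 - X$2 * b$3)
      - (b$1 * X$3 - X$1 * b$3) * (a$2 * X$3 - X$2 * a$3)) / (X$3) ^ 4"
    by (simp only: times_divide_times_eq diff_divide_distrib[symmetric] power_add[symmetric]) simp
  also have "(a$1 * X$3 - X$1 * a$3) * (b$2 * X$3 - X$2 * b$3)
      - (b$1 * X$3 - X$1 * b$3) * (a$2 * X$3 - X$2 * a$3) = X$3 * triple a b X"
    unfolding triple_def by algebra
  \<comment> \<open>\<open>X - c\<close> lies in the span of \<open>a\<close> and \<open>b\<close>,
    so the determinant does not notice it.\<close>
  also have "triple a b X = triple a b c"
    by (simp add: triple_def X_def cone_point_def algebra_simps)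
  finally show "det (matrix (\<lambda>h. vector [d 1 h, d 2 h] :: real^2)) = triple a b c / (X$3) ^ 3"
    using assms(2) by (simp add: power4_eq_xxxx power3_eq_cube)
qed

text \<open>Equal projections mean proportional cone points. Replacing one vertex at a time by the
  cone point gives determinants that recover the factor 1 and then both coordinates.\<close>

lemma cone_map_inj:
  assumes abc: "a \<in> hyperboloid" "b \<in> hyperboloid" "c \<in> hyperboloid" and D: "triple a b c \<noteq> 0"
  shows "inj_on (\<lambda>x. klein_proj (cone_point a b c x)) quadrant"
proof (rule inj_onI)
  fix x y assume xy: "x \<in> quadrant" "y \<in> quadrant"
    and eq: "klein_proj (cone_point a b c x) = klein_proj (cone_point a b c y)"
  define X Y where "X = cone_point a b c x" and "Y = cone_point a b c y"
  have pos: "0 < X$3" "0 < Y$3" using cone_point_hyperboloid(1)[OF abc] xy by (simp_all add: X_def Y_def)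
  define l where "l = X$3 / Y$3"
  have "X$1 / X$3 = Y$1 / Y$3" "X$2 / X$3 = Y$2 / Y$3"
    using eq klein_proj_nth unfolding X_def Y_def by metis+
  then have X: "X = l *\<^sub>R Y"
    using pos by (intro vec3_eqI) (simp_all add: l_def field_simps)
  have sc: "triple a b (l *\<^sub>R Y) = l * triple a b Y" "triple (l *\<^sub>R Y) b c = l * triple Y b c"
    "triple a (l *\<^sub>R Y) c = l * triple a Y c"
    by (simp_all add: triple_def algebra_simps)
  have co: "triple a b (cone_point a b c z) = triple a b c"
    "triple (cone_point a b c z) b c = z$1 * triple a b c"
    "triple a (cone_point a b c z) c = z$2 * triple a b c" for z
    by (simp_all add: triple_def cone_point_def algebra_simps)
  have "triple a b c = l * triple a b c" using sc(1) co(1) X by (metis X_def Y_def)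
  then have l: "l = 1" using D by simp
  have "x$1 * triple a b c = y$1 * triple a b c" "x$2 * triple a b c = y$2 * triple a b c"
    using co(2,3) X l by (metis X_def Y_def scaleR_one)+
  then show "x = y" using D by (simp add: vec_eq_iff forall_2)
qed

text \<open>In barycentric coordinates the map sends \<open>x\<close> to the weights
  \<open>x$1 * s A\<close>, \<open>x$2 * s B\<close>, \<open>s C\<close>, divided by their sum;
  these range over all positive triples of sum 1.\<close>

lemma cone_map_image:
  assumes ABC: "A \<in> hplane" "B \<in> hplane" "C \<in> hplane" and nc: "\<not> collinear {A, B, C}"
  defines "g \<equiv> \<lambda>x. klein_proj (cone_point (klein_lift A) (klein_lift B) (klein_lift C) x)"
  shows "g ` quadrant = interior (convex hull {A, B, C})"
proof -
  define s where "s P = 1 / sqrt (1 - P \<bullet> P)" for P :: "real^2"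
  have s: "0 < s A" "0 < s B" "0 < s C" using ABC by (simp_all add: s_def hplane_iff)
  have g: "g x = (x$1 * s A / (x$1 * s A + x$2 * s B + s C)) *\<^sub>R A
      + (x$2 * s B / (x$1 * s A + x$2 * s B + s C)) *\<^sub>R B
      + (s C / (x$1 * s A + x$2 * s B + s C)) *\<^sub>R C" for x
    by (simp add: g_def vec_eq_iff forall_2 klein_proj_nth cone_point_def klein_lift_nth s_def
        add_divide_distrib)
  have "interior (convex hull {A, B, C}) = {v. \<exists>p q r. 0 < p \<and> 0 < q \<and> 0 < r \<and> p + q + r = 1
      \<and> p *\<^sub>R A + q *\<^sub>R B + r *\<^sub>R C = v}"
    by (rule interior_convex_hull_3_minimal[OF nc]) simp
  also have "\<dots> = g ` quadrant"
  proof (intro equalityI subsetI)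
    fix v assume "v \<in> {v. \<exists>p q r. 0 < p \<and> 0 < q \<and> 0 < r \<and> p + q + r = 1
      \<and> p *\<^sub>R A + q *\<^sub>R B + r *\<^sub>R C = v}"
    then obtain p q r where pqr: "0 < p" "0 < q" "0 < r" "p + q + r = 1"
      and v: "v = p *\<^sub>R A + q *\<^sub>R B + r *\<^sub>R C" by blast
    \<comment> \<open>Solves for the weights \<open>p\<close>, \<open>q\<close>, \<open>r\<close>.
      The total is \<open>s C / r\<close> because the weight of \<open>C\<close> is not
      free.\<close>
    define x :: "real^2" where "x = vector [p * s C / (r * s A), q * s C / (r * s B)]"
    have 1: "x$1 * s A = p * (s C / r)" "x$2 * s B = q * (s C / r)" "s C = r * (s C / r)"
      using pqr s by (simp_all add: x_def)
    then have "x$1 * s A + x$2 * s B + s C = p * (s C / r) + q * (s C / r) + r * (s C / r)"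
      by linarith
    also have "\<dots> = (p + q + r) * (s C / r)" by (simp only: distrib_right)
    finally have "x$1 * s A + x$2 * s B + s C = (p + q + r) * (s C / r)" .
    then have 2: "x$1 * s A + x$2 * s B + s C = s C / r" using pqr by simp
    have "g x = p *\<^sub>R A + q *\<^sub>R B + r *\<^sub>R C"
      unfolding g 2 using s pqr 1 by simp
    moreover have "x \<in> quadrant" using pqr s by (simp add: quadrant_def x_def)
    ultimately show "v \<in> g ` quadrant" using v by (metis image_eqI)
  next
    fix v assume "v \<in> g ` quadrant"
    then obtain x where x: "0 < x$1" "0 < x$2" "v = g x" by (auto simp: quadrant_def)
    define t where "t = x$1 * s A + x$2 * s B + s C"
    have t: "0 < t" using x s by (simp add: t_def add_pos_pos)
    have "x$1 * s A / t + x$2 * s B / t + s C / t = 1"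
      using t by (simp add: add_divide_distrib[symmetric] t_def)
    moreover have "0 < x$1 * s A / t" "0 < x$2 * s B / t" "0 < s C / t" using x s t by simp_all
    ultimately show "v \<in> {v. \<exists>p q r. 0 < p \<and> 0 < q \<and> 0 < r \<and> p + q + r = 1
      \<and> p *\<^sub>R A + q *\<^sub>R B + r *\<^sub>R C = v}"
      using x(3) g[of x, folded t_def] by (metis (mono_tags, lifting) mem_Collect_eq)
  qed
  finally show ?thesis by simp
qed

text \<open>As the integrand is nonnegative, the iterated integral yields both integrability and the
  value. Passing to the completion \<open>lebesgue\<close> gives the form needed for the change of
  variables.\<close>

lemma quadrant_integral:
  fixes \<alpha> \<beta> \<gamma> D :: real
  assumes pos: "0 < \<alpha>" "0 < \<beta>" "0 < \<gamma>" "0 < D"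
    and D: "D\<^sup>2 = 1 + 2 * \<alpha> * \<beta> * \<gamma> - \<alpha>\<^sup>2 - \<beta>\<^sup>2 - \<gamma>\<^sup>2"
  defines "f \<equiv> \<lambda>x :: real^2. D / sqrt ((x$1)\<^sup>2 + (x$2)\<^sup>2 + 1
      + 2 * x$1 * x$2 * \<gamma> + 2 * x$1 * \<beta> + 2 * x$2 * \<alpha>) ^ 3"
  shows "f absolutely_integrable_on quadrant"
    and "integral quadrant f = pi - 2 * arctan ((1 + \<alpha> + \<beta> + \<gamma>) / D)"
proof -
  define V where "V = pi - 2 * arctan ((1 + \<alpha> + \<beta> + \<gamma>) / D)"
  have "arctan ((1 + \<alpha> + \<beta> + \<gamma>) / D) < pi / 2" by (rule arctan_ubound)
  then have V: "0 \<le> V" by (simp add: V_def)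
  have nthm: "(\<lambda>x :: real^2. x$i) \<in> borel_measurable borel" for i
    by (intro borel_measurable_continuous_onI continuous_intros)
  have fm: "f \<in> borel_measurable borel"
    unfolding f_def using nthm by measurable
  define k where "k x = indicator quadrant x *\<^sub>R f x" for x
  have km: "k \<in> borel_measurable borel"
    unfolding k_def using fm quadrant_borel by measurable
  have "(\<integral>\<^sup>+x. ennreal (k x) \<partial>lborel)
      = (\<integral>\<^sup>+p. ennreal (k (case p of (u, v) \<Rightarrow> vector [u, v])) \<partial>(lborel \<Otimes>\<^sub>M lborel))"
    unfolding lborel_real2_eq_distr
    by (rule nn_integral_distr[OF vector_2_borel_measurable]) (use km in measurable)
  also have "\<dots> = (\<integral>\<^sup>+v. (\<integral>\<^sup>+u. ennreal (k (vector [u, v])) \<partial>lborel) \<partial>lborel)"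
    using lborel_pair.nn_integral_snd[of "\<lambda>p. ennreal (k (case p of (u, v) \<Rightarrow> vector [u, v]))"]
      measurable_compose[OF vector_2_borel_measurable km] by simp
  also have "\<dots> = (\<integral>\<^sup>+v. (\<integral>\<^sup>+u. ennreal (D / sqrt (u\<^sup>2 + v\<^sup>2 + 1 + 2 * u * v * \<gamma> + 2 * u * \<beta> + 2 * v * \<alpha>) ^ 3)
      * indicator {0<..} u \<partial>lborel) * indicator {0<..} v \<partial>lborel)"
    by (intro nn_integral_cong)
       (auto simp: k_def f_def quadrant_def indicator_def intro!: nn_integral_cong)
  also have "\<dots> = ennreal V"
    unfolding V_def by (rule nn_integral_quadrant[OF pos D])
  finally have "(\<integral>\<^sup>+x. ennreal (k x) \<partial>lborel) = ennreal V" .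
  moreover have "0 \<le> k x" for x
    using pos by (auto simp: k_def f_def quadrant_def indicator_def)
  ultimately have "has_bochner_integral lborel k V"
    using km V by (intro has_bochner_integral_nn_integral) auto
  then have "integrable lebesgue k" "integral\<^sup>L lebesgue k = V"
    using km by (auto simp: has_bochner_integral_iff integrable_completion integral_completion)
  then have I: "set_integrable lebesgue quadrant f" "(LINT x:quadrant|lebesgue. f x) = V"
    by (simp_all add: set_integrable_def set_lebesgue_integral_def k_def[abs_def])
  then show "f absolutely_integrable_on quadrant" by simp
  show "integral quadrant f = pi - 2 * arctan ((1 + \<alpha> + \<beta> + \<gamma>) / D)"
    using I set_lebesgue_integral_eq_integral(2)[OF I(1)] by (simp add: V_def)
qed

text \<open>The cone map reaches only the interior, but the frontier of a convex set is
  null.\<close>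

lemma harea_convex:
  assumes "compact T" "convex T"
    and "(\<lambda>x. 1 / sqrt (1 - x \<bullet> x) ^ 3) absolutely_integrable_on interior T"
  shows "harea T = integral (interior T) (\<lambda>x. 1 / sqrt (1 - x \<bullet> x) ^ 3)"
proof -
  define f :: "real^2 \<Rightarrow> real" where "f x = 1 / sqrt (1 - x \<bullet> x) ^ 3" for x
  have fm: "f \<in> borel_measurable borel" unfolding f_def by measurable
  have T: "T \<in> sets borel" using assms(1) by (simp add: compact_imp_closed)
  have m: "set_borel_measurable lborel S f" if "S \<in> sets borel" for S
    unfolding set_borel_measurable_def using fm that by measurable
  have "frontier T \<in> null_sets lborel"
    using negligible_convex_frontier[OF assms(2)]
    by (simp add: negligible_iff_null_sets null_sets_completion_iff)
  then have "AE x in lborel. x \<notin> frontier T" by (rule AE_not_in)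
  then have "AE x in lborel. x \<in> interior T \<longleftrightarrow> x \<in> T"
    by (rule eventually_mono) (use assms(1) interior_subset in \<open>auto simp: frontier_def compact_imp_closed\<close>)
  then have "(LINT x:T|lborel. f x) = (LINT x:interior T|lborel. f x)"
    by (intro set_integral_cong_set m T) auto
  also have "\<dots> = (LINT x:interior T|lebesgue. f x)"
    unfolding set_lebesgue_integral_def
    by (rule integral_completion[symmetric]) (use fm in measurable)
  also have "\<dots> = integral (interior T) f"
    using assms(3) by (intro set_lebesgue_integral_eq_integral) (simp add: f_def)
  finally show ?thesis by (simp add: harea_def f_def[abs_def])
qed

text \<open>Change of variables along the cone map. The right side is twice the arctan of the
  reciprocal quotient, that is, the formula for \<open>tan (area / 2)\<close>.\<close>

theorem htriangle_area_eq:
  assumes "htriangle A B C"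
  defines "a \<equiv> klein_lift A" and "b \<equiv> klein_lift B" and "c \<equiv> klein_lift C"
  shows "htriangle_area A B C
    = pi - 2 * arctan ((1 + mink b c + mink c a + mink a b) / \<bar>triple a b c\<bar>)"
proof -
  have ABC: "A \<in> hplane" "B \<in> hplane" "C \<in> hplane" and nc: "\<not> collinear {A, B, C}"
    using assms(1) by (auto simp: htriangle_iff)
  have abc: "a \<in> hyperboloid" "b \<in> hyperboloid" "c \<in> hyperboloid"
    using ABC klein_lift_hyperboloid by (simp_all add: a_def b_def c_def)
  have D: "triple a b c \<noteq> 0"
    using ABC nc by (simp add: a_def b_def c_def triple_klein_lift_eq_0_iff cross2_eq_0_iff_collinear)
  define g where "g x = klein_proj (cone_point a b c x)" for x
  define f :: "real^2 \<Rightarrow> real" where "f x = 1 / sqrt (1 - x \<bullet> x) ^ 3" for x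
  define d where "d x i h = ((h$1 * a$i + h$2 * b$i) * cone_point a b c x $ 3
    - cone_point a b c x $ i * (h$1 * a$3 + h$2 * b$3)) / (cone_point a b c x $ 3)\<^sup>2" for x i and h :: "real^2"
  define g' where "g' x h = (vector [d x 1 h, d x 2 h] :: real^2)" for x h
  define F where "F x = \<bar>triple a b c\<bar> / sqrt ((x$1)\<^sup>2 + (x$2)\<^sup>2 + 1
      + 2 * x$1 * x$2 * mink a b + 2 * x$1 * mink c a + 2 * x$2 * mink b c) ^ 3" for x :: "real^2"
  \<comment> \<open>The cube of \<open>X$3\<close> in the denominator of the Jacobian cancels
    against the one that the density acquires under projection.\<close>
  have F: "\<bar>det (matrix (g' x))\<bar> * f (g x) = F x" if "x \<in> quadrant" for x
  proof -
    define X where "X = cone_point a b c x"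
    have X: "0 < X$3" "0 < mink X X" using cone_point_hyperboloid[OF abc that] by (simp_all add: X_def)
    have "det (matrix (g' x)) = triple a b c / (X$3) ^ 3"
      unfolding g'_def[abs_def] X_def d_def
      by (rule cone_map_has_derivative(2)) (use X in \<open>simp add: X_def\<close>)
    moreover have "sqrt (1 - g x \<bullet> g x) = sqrt (mink X X) / X$3"
      using X by (simp add: g_def X_def[symmetric] klein_proj_inner real_sqrt_divide)
    moreover have "F x = \<bar>triple a b c\<bar> / sqrt (mink X X) ^ 3"
      using cone_point_hyperboloid(3)[OF abc that] by (simp add: F_def X_def)
    ultimately show ?thesis using X by (simp add: f_def power_divide)
  qed
  have pos: "0 < mink b c" "0 < mink c a" "0 < mink a b"
    using mink_eq_1_or_greater(1) abc by (meson less_le_trans zero_less_one)+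
  have "\<bar>triple a b c\<bar>\<^sup>2 = 1 + 2 * mink b c * mink c a * mink a b
      - (mink b c)\<^sup>2 - (mink c a)\<^sup>2 - (mink a b)\<^sup>2"
    using triple_hyperboloid[OF abc] by simp
  note I = quadrant_integral[OF pos _ this, folded F_def]
  have "(\<lambda>x. \<bar>det (matrix (g' x))\<bar> * f (g x)) absolutely_integrable_on quadrant"
    using I(1) D F by (subst set_integrable_cong[OF refl refl F]) simp_all
  moreover have "integral quadrant (\<lambda>x. \<bar>det (matrix (g' x))\<bar> * f (g x))
      = pi - 2 * arctan ((1 + mink b c + mink c a + mink a b) / \<bar>triple a b c\<bar>)"
    using I(2) D by (subst integral_cong[OF F]) simp_all
  moreover have "(g has_derivative g' x) (at x within quadrant)" if "x \<in> quadrant" for x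
    unfolding g_def[abs_def] g'_def[abs_def] d_def
    by (rule cone_map_has_derivative(1)) (use cone_point_hyperboloid(1)[OF abc that] in simp)
  moreover have "inj_on g quadrant"
    unfolding g_def[abs_def] by (rule cone_map_inj[OF abc D])
  moreover have "quadrant \<in> sets lebesgue"
    using quadrant_borel by simp
  ultimately have "f absolutely_integrable_on g ` quadrant \<and> integral (g ` quadrant) f
      = pi - 2 * arctan ((1 + mink b c + mink c a + mink a b) / \<bar>triple a b c\<bar>)"
    using has_absolute_integral_change_of_variables_scalar[of quadrant g g' f] by blast
  moreover have "g ` quadrant = interior (convex hull {A, B, C})"
    unfolding g_def[abs_def] a_def b_def c_def by (rule cone_map_image[OF ABC nc])
  moreover have "htriangle_area A B C = harea (convex hull {A, B, C})"
    using ABC by (simp add: htriangle_area_def hconvex_hull_eq)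
  ultimately show ?thesis
    using harea_convex[of "convex hull {A, B, C}"]
    by (simp add: f_def[abs_def] compact_convex_hull finite_imp_compact)
qed

subsection \<open>Congruence of triangles with equal sides\<close>

text \<open>Cramer's rule; after clearing denominators each coordinate is a polynomial
  identity.\<close>

lemma triple_cramer:
  assumes "triple a b c \<noteq> 0"
  shows "p = (triple p b c / triple a b c) *\<^sub>R a + (triple a p c / triple a b c) *\<^sub>R b
    + (triple a b p / triple a b c) *\<^sub>R c"
proof -
  have "triple a b c * p$1 = triple p b c * a$1 + triple a p c * b$1 + triple a b p * c$1"
    and "triple a b c * p$2 = triple p b c * a$2 + triple a p c * b$2 + triple a b p * c$2"
    and "triple a b c * p$3 = triple p b c * a$3 + triple a p c * b$3 + triple a b p * c$3"
    unfolding triple_def by algebra+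
  then have "\<forall>i. triple a b c * p$i = triple p b c * a$i + triple a p c * b$i + triple a b p * c$i"
    by (simp add: forall_3)
  then have "p$i = (triple p b c * a$i + triple a p c * b$i + triple a b p * c$i) / triple a b c" for i
    using assms by (metis nonzero_mult_div_cancel_left)
  then show ?thesis by (intro vec3_eqI) (simp_all add: add_divide_distrib)
qed

text \<open>For a basis \<open>a\<close>, \<open>b\<close>, \<open>c\<close> this is the linear map
  taking it to \<open>a'\<close>, \<open>b'\<close>, \<open>c'\<close>, with the coordinates of
  \<open>p\<close> given by Cramer's rule.\<close>

definition frame_map :: "(real^3) \<times> (real^3) \<times> (real^3) \<Rightarrow> (real^3) \<times> (real^3) \<times> (real^3) \<Rightarrow> real^3 \<Rightarrow> real^3" where
  "frame_map = (\<lambda>(a, b, c) (a', b', c') p. (triple p b c / triple a b c) *\<^sub>R a'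
    + (triple a p c / triple a b c) *\<^sub>R b' + (triple a b p / triple a b c) *\<^sub>R c')"

lemma frame_map_combination:
  assumes "triple a b c \<noteq> 0"
  shows "frame_map (a, b, c) (a', b', c') (r *\<^sub>R a + s *\<^sub>R b + t *\<^sub>R c) = r *\<^sub>R a' + s *\<^sub>R b' + t *\<^sub>R c'"
proof -
  have "triple (r *\<^sub>R a + s *\<^sub>R b + t *\<^sub>R c) b c = r * triple a b c"
    "triple a (r *\<^sub>R a + s *\<^sub>R b + t *\<^sub>R c) c = s * triple a b c"
    "triple a b (r *\<^sub>R a + s *\<^sub>R b + t *\<^sub>R c) = t * triple a b c"
    by (simp_all add: triple_def algebra_simps)
  then show ?thesis using assms by (simp add: frame_map_def)
qed

lemma frame_map_inverse:
  assumes "triple a b c \<noteq> 0" "triple a' b' c' \<noteq> 0"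
  shows "frame_map (a', b', c') (a, b, c) (frame_map (a, b, c) (a', b', c') p) = p"
proof -
  obtain r s t where p: "p = r *\<^sub>R a + s *\<^sub>R b + t *\<^sub>R c" using triple_cramer[OF assms(1)] by blast
  show ?thesis unfolding p frame_map_combination[OF assms(1)] frame_map_combination[OF assms(2)] ..
qed

lemma frame_map_vertices:
  assumes "triple a b c \<noteq> 0"
  shows "frame_map (a, b, c) (a', b', c') a = a'"
    and "frame_map (a, b, c) (a', b', c') b = b'"
    and "frame_map (a, b, c) (a', b', c') c = c'"
  using frame_map_combination[OF assms, of a' b' c' 1 0 0] frame_map_combination[OF assms, of a' b' c' 0 1 0]
    frame_map_combination[OF assms, of a' b' c' 0 0 1] by simp_all

text \<open>A linear map respects a bilinear form once it respects the Gram matrix of a basis; here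
  the diagonal entries are all 1.\<close>

lemma frame_map_mink:
  assumes D: "triple a b c \<noteq> 0"
    and abc: "a \<in> hyperboloid" "b \<in> hyperboloid" "c \<in> hyperboloid"
    and abc': "a' \<in> hyperboloid" "b' \<in> hyperboloid" "c' \<in> hyperboloid"
    and eq: "mink a' b' = mink a b" "mink b' c' = mink b c" "mink c' a' = mink c a"
  shows "mink (frame_map (a, b, c) (a', b', c') p) (frame_map (a, b, c) (a', b', c') q) = mink p q"
proof -
  obtain r s t where p: "p = r *\<^sub>R a + s *\<^sub>R b + t *\<^sub>R c" using triple_cramer[OF D] by blast
  obtain u v w where q: "q = u *\<^sub>R a + v *\<^sub>R b + w *\<^sub>R c" using triple_cramer[OF D] by blast
  have "mink a' a' = mink a a" "mink b' b' = mink b b" "mink c' c' = mink c c"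
    using abc abc' by (simp_all add: hyperboloid_def)
  moreover have "mink b' a' = mink b a" "mink c' b' = mink c b" "mink a' c' = mink a c"
    using eq by (metis mink_commute)+
  ultimately show ?thesis
    unfolding p q frame_map_combination[OF D] using eq by (simp add: mink_simps)
qed

text \<open>A linear isometry might exchange the two sheets. Products across sheets are at most -1,
  so a single positive product decides.\<close>

lemma hyperboloid_if_mink_pos:
  assumes "mink u u = 1" "v \<in> hyperboloid" "0 < mink u v"
  shows "u \<in> hyperboloid"
proof (rule ccontr)
  assume "u \<notin> hyperboloid"
  then have "u$3 \<le> 0" using assms(1) by (auto simp: hyperboloid_def)
  moreover have "u$3 \<noteq> 0"
  proof
    assume "u$3 = 0"
    then have "- ((u$1)\<^sup>2 + (u$2)\<^sup>2) = 1" using assms(1) by (simp add: mink_def power2_eq_square)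
    then show False using sum_power2_ge_zero[of "u$1" "u$2"] by linarith
  qed
  ultimately have "(-1) *\<^sub>R u \<in> hyperboloid"
    using assms(1) by (simp add: hyperboloid_def mink_def)
  then have "1 \<le> mink ((-1) *\<^sub>R u) v" using assms(2) by (rule mink_eq_1_or_greater(1))
  then show False using assms(3) by (simp only: mink_scale_left)
qed

text \<open>Equal sides give the lifted vertices equal Gram matrices, so the frame map preserves the
  Minkowski form and descends to an isometry of the disc, possibly orientation reversing.\<close>

lemma hcongruent_if_sides_eq:
  assumes "htriangle A B C" "htriangle A' B' C'"
    and eq: "hdist A' B' = hdist A B" "hdist B' C' = hdist B C" "hdist C' A' = hdist C A"
  shows "hcongruent A B C A' B' C'"
proof -
  note H = klein_lift_hyperboloid
  have ABC: "A \<in> hplane" "B \<in> hplane" "C \<in> hplane"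
    and ABC': "A' \<in> hplane" "B' \<in> hplane" "C' \<in> hplane"
    using assms by (auto simp: htriangle_iff)
  define a b c where abc_def: "a = klein_lift A" "b = klein_lift B" "c = klein_lift C"
  define a' b' c' where abc'_def: "a' = klein_lift A'" "b' = klein_lift B'" "c' = klein_lift C'"
  have abc: "a \<in> hyperboloid" "b \<in> hyperboloid" "c \<in> hyperboloid"
    and abc': "a' \<in> hyperboloid" "b' \<in> hyperboloid" "c' \<in> hyperboloid"
    using ABC ABC' H by (simp_all add: abc_def abc'_def)
  have D: "triple a b c \<noteq> 0" "triple a' b' c' \<noteq> 0"
    using assms(1,2) ABC ABC'
    by (simp_all add: abc_def abc'_def htriangle_iff triple_klein_lift_eq_0_iff cross2_eq_0_iff_collinear)
  have m: "mink a' b' = mink a b" "mink b' c' = mink b c" "mink c' a' = mink c a"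
    using eq ABC ABC' cosh_hdist unfolding abc_def abc'_def by metis+
  define L where "L = frame_map (a, b, c) (a', b', c')"
  define L' where "L' = frame_map (a', b', c') (a, b, c)"
  have LL': "L' (L p) = p" "L (L' p) = p" for p
    unfolding L_def L'_def using frame_map_inverse D by blast+
  have mL: "mink (L p) (L q) = mink p q" for p q
    unfolding L_def by (rule frame_map_mink[OF D(1) abc abc' m])
  then have mL': "mink (L' p) (L' q) = mink p q" for p q by (metis LL'(2))
  have La: "L a = a'" "L b = b'" "L c = c'"
    unfolding L_def using frame_map_vertices[OF D(1)] by simp_all
  \<comment> \<open>The vertex \<open>a'\<close> is the reference point on the upper sheet.\<close>
  have hyp: "L p \<in> hyperboloid" if "p \<in> hyperboloid" for p
  proof (rule hyperboloid_if_mink_pos[OF _ abc'(1)])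
    show "mink (L p) (L p) = 1" using that by (simp add: mL hyperboloid_def)
    show "0 < mink (L p) a'"
      using mL[of p a] mink_eq_1_or_greater(1)[OF that abc(1)] La by simp
  qed
  have hyp': "L' p \<in> hyperboloid" if "p \<in> hyperboloid" for p
  proof (rule hyperboloid_if_mink_pos[OF _ abc(1)])
    show "mink (L' p) (L' p) = 1" using that by (simp add: mL' hyperboloid_def)
    show "0 < mink (L' p) a"
      using mL'[of p a'] mink_eq_1_or_greater(1)[OF that abc'(1)] LL'(1)[of a] La by simp
  qed
  define f where "f x = klein_proj (L (klein_lift x))" for x
  have lift_f: "klein_lift (f x) = L (klein_lift x)" if "x \<in> hplane" for x
    using that by (simp add: f_def klein_lift_proj hyp H)
  have "f ` hplane = hplane"
  proof (intro equalityI subsetI)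
    fix y assume "y \<in> f ` hplane"
    then show "y \<in> hplane" by (auto simp: f_def hyp H hyperboloid_proj_hplane)
  next
    fix y assume y: "y \<in> hplane"
    define x where "x = klein_proj (L' (klein_lift y))"
    have "x \<in> hplane" using y by (simp add: x_def hyp' H hyperboloid_proj_hplane)
    moreover have "f x = y"
      using y by (simp add: f_def x_def klein_lift_proj hyp' H LL' klein_proj_lift)
    ultimately show "y \<in> f ` hplane" by blast
  qed
  moreover have "hdist (f x) (f y) = hdist x y" if "x \<in> hplane" "y \<in> hplane" for x y
    using that by (simp add: hdist_mink lift_f mL)
  ultimately have "hisometry f" by (simp add: hisometry_def)
  moreover have "f A = A'" "f B = B'" "f C = C'"
    using La ABC' by (simp_all add: f_def abc_def abc'_def klein_proj_lift)
  ultimately show ?thesis unfolding hcongruent_def by blast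
qed

subsection \<open>The maximal area\<close>

text \<open>Hyperbolic Heron formula: as a quadratic in \<open>g\<close>, the Gram determinant has
  the roots \<open>cosh (x + y)\<close> and \<open>cosh (x - y)\<close>.\<close>

lemma heron_cosh:
  fixes x y g :: real
  shows "1 + 2 * cosh x * cosh y * g - (cosh x)\<^sup>2 - (cosh y)\<^sup>2 - g\<^sup>2
    = (cosh (x + y) - g) * (g - cosh (x - y))"
proof -
  have "(sinh x)\<^sup>2 = (cosh x)\<^sup>2 - 1" "(sinh y)\<^sup>2 = (cosh y)\<^sup>2 - 1" by (simp_all add: sinh_square_eq)
  then show ?thesis unfolding cosh_add cosh_diff by algebra
qed

lemma cosh_add_cosh:
  fixes x y :: real
  shows "cosh x + cosh y = 2 * cosh ((x + y) / 2) * cosh ((x - y) / 2)"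
proof -
  have "cosh ((x + y) / 2 + (x - y) / 2) + cosh ((x + y) / 2 - (x - y) / 2)
      = 2 * cosh ((x + y) / 2) * cosh ((x - y) / 2)"
    unfolding cosh_add cosh_diff by simp
  moreover have "(x + y) / 2 + (x - y) / 2 = x" "(x + y) / 2 - (x - y) / 2 = y"
    by (simp_all add: field_simps)
  ultimately show ?thesis by simp
qed

text \<open>
  The area of a triangle with base \<open>z\<close> and perimeter \<open>z + s\<close>, in terms of \<open>k = cosh ((x - y) / 2)\<close>
  where \<open>x\<close> and \<open>y\<close> are the other two sides.
\<close>

definition base_area :: "real \<Rightarrow> real \<Rightarrow> real \<Rightarrow> real" where
  "base_area z s k = pi - 2 * arctan ((1 + cosh z + 2 * cosh (s / 2) * k)
     / sqrt ((cosh s - cosh z) * (cosh z + 1 - 2 * k\<^sup>2)))"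

text \<open>With growing \<open>k\<close> the numerator increases strictly and the root below it
  does not increase, so the arctan increases. The last hypothesis keeps the radicand
  positive.\<close>

lemma base_area_less:
  assumes "0 \<le> z" "z < s" "1 < k" "2 * k\<^sup>2 < cosh z + 1"
  shows "base_area z s k < base_area z s 1"
proof -
  define M where "M = cosh s - cosh z"
  have M: "0 < M" using assms(1,2) by (simp add: M_def cosh_real_nonneg_less_iff)
  have k: "1 < k\<^sup>2" using assms(3) by simp
  have "0 < 1 + cosh z + 2 * cosh (s / 2) * 1"
    by (intro add_pos_pos mult_pos_pos) simp_all
  moreover have "1 + cosh z + 2 * cosh (s / 2) * 1 < 1 + cosh z + 2 * cosh (s / 2) * k"
    using assms(3) by simp
  moreover have "sqrt (M * (cosh z + 1 - 2 * k\<^sup>2)) \<le> sqrt (M * (cosh z + 1 - 2 * 1\<^sup>2))"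
    using M k by simp
  moreover have "0 < sqrt (M * (cosh z + 1 - 2 * k\<^sup>2))"
    using M assms(4) by simp
  ultimately have "(1 + cosh z + 2 * cosh (s / 2) * 1) / sqrt (M * (cosh z + 1 - 2 * 1\<^sup>2))
      < (1 + cosh z + 2 * cosh (s / 2) * k) / sqrt (M * (cosh z + 1 - 2 * k\<^sup>2))"
    by (intro frac_less) simp_all
  from arctan_monotone[OF this] show ?thesis by (simp add: base_area_def M_def)
qed

text \<open>By the Heron factorisation, the positive Gram determinant of a nondegenerate triangle
  gives \<open>cosh (x - y) < cosh z\<close>; in terms of \<open>k\<close> this is the second
  claim.\<close>

lemma base_perimeter_triangle_area:
  assumes T: "base_perimeter_triangle z P A B C" and P: "2 * z < P"
  defines "k \<equiv> cosh ((hdist B C - hdist A C) / 2)"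
  shows "htriangle_area A B C = base_area z (P - z) k" and "2 * k\<^sup>2 < cosh z + 1"
proof -
  have t: "htriangle A B C" and z: "hdist A B = z" and p: "hdist A B + hdist B C + hdist C A = P"
    using T by (auto simp: base_perimeter_triangle_def hperimeter_def)
  have ABC: "A \<in> hplane" "B \<in> hplane" "C \<in> hplane" and nc: "\<not> collinear {A, B, C}"
    using t by (auto simp: htriangle_iff)
  define x y where "x = hdist B C" and "y = hdist C A"
  have s: "x + y = P - z" using p z by (simp add: x_def y_def)
  have k: "k = cosh ((x - y) / 2)" by (simp add: k_def x_def y_def hdist_commute)
  define D where "D = triple (klein_lift A) (klein_lift B) (klein_lift C)"
  have m: "mink (klein_lift B) (klein_lift C) = cosh x" "mink (klein_lift C) (klein_lift A) = cosh y"
    "mink (klein_lift A) (klein_lift B) = cosh z"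
    using cosh_hdist[OF ABC(2,3)] cosh_hdist[OF ABC(3,1)] cosh_hdist[OF ABC(1,2)] z
    by (simp_all add: x_def y_def)
  have "D \<noteq> 0"
    using ABC nc by (simp add: D_def triple_klein_lift_eq_0_iff cross2_eq_0_iff_collinear)
  have "2 * ((x - y) / 2) = x - y" by (simp add: field_simps)
  then have "cosh (x - y) = 2 * k\<^sup>2 - 1"
    using cosh_double_cosh[of "(x - y) / 2"] by (simp only: k)
  then have "cosh z - cosh (x - y) = cosh z + 1 - 2 * k\<^sup>2" by linarith
  moreover have "D\<^sup>2 = (cosh (x + y) - cosh z) * (cosh z - cosh (x - y))"
    unfolding D_def using ABC
    by (subst triple_hyperboloid) (simp_all add: klein_lift_hyperboloid m heron_cosh)
  ultimately have D2: "D\<^sup>2 = (cosh (P - z) - cosh z) * (cosh z + 1 - 2 * k\<^sup>2)"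
    by (simp only: s)
  have "0 \<le> z" using hdist_nonneg[OF ABC(1,2)] z by simp
  then have "cosh z < cosh (P - z)" using P by (simp add: cosh_real_nonneg_less_iff)
  moreover have "0 < D\<^sup>2" using \<open>D \<noteq> 0\<close> by simp
  ultimately show "2 * k\<^sup>2 < cosh z + 1"
    unfolding D2 by (simp add: zero_less_mult_iff)
  have "\<bar>D\<bar> = sqrt ((cosh (P - z) - cosh z) * (cosh z + 1 - 2 * k\<^sup>2))"
    using D2 by (metis real_sqrt_abs)
  moreover have "1 + cosh x + cosh y + cosh z = 1 + cosh z + 2 * cosh ((P - z) / 2) * k"
    using cosh_add_cosh[of x y] s k by simp
  ultimately show "htriangle_area A B C = base_area z (P - z) k"
    using htriangle_area_eq[OF t] by (simp only: m D_def[symmetric] base_area_def)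
qed

text \<open>The base is placed symmetrically about the centre of the disc and the apex on the
  perpendicular axis.\<close>

lemma exists_isosceles_triangle:
  assumes "0 < z" "2 * z < P"
  shows "\<exists>A B C. base_perimeter_triangle z P A B C \<and> hdist A C = hdist B C"
proof -
  define s where "s = (P - z) / 2"
  \<comment> \<open>A point at hyperbolic distance \<open>t\<close> from the centre has Euclidean
    norm \<open>tanh t\<close>.\<close>
  define h where "h = tanh (z / 2)"
  \<comment> \<open>By the hyperbolic Pythagorean theorem \<open>q\<close> is the hyperbolic cosine
    of the height for legs of length \<open>s\<close>, and \<open>k\<close> below is the hyperbolic
    tangent of that height.\<close>
  define q where "q = cosh s / cosh (z / 2)"
  define k where "k = sqrt (1 - 1 / q\<^sup>2)"
  have "cosh (z / 2) < cosh s" using assms by (simp add: s_def cosh_real_nonneg_less_iff)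
  then have q: "1 < q" by (simp add: q_def)
  then have q2: "1 < q\<^sup>2" by simp
  then have "1 / q\<^sup>2 < 1" by (subst divide_less_eq) auto
  then have k: "0 < k" "k * k = 1 - 1 / q\<^sup>2"
    by (simp_all add: k_def)
  have h: "0 < h" using assms by (simp add: h_def)
  have ch: "0 < cosh (z / 2)" by simp
  have sq: "(sinh (z / 2))\<^sup>2 = (cosh (z / 2))\<^sup>2 - 1" by (rule sinh_square_eq)
  have hh: "1 - h * h = 1 / (cosh (z / 2))\<^sup>2"
  proof -
    have "h * h = ((cosh (z / 2))\<^sup>2 - 1) / (cosh (z / 2))\<^sup>2"
      by (simp add: h_def tanh_def power2_eq_square[symmetric] power_divide sq)
    then show ?thesis using ch by (simp add: diff_divide_distrib)
  qed
  define A B C :: "real^2" where ABC_def: "A = vector [-h, 0]" "B = vector [h, 0]" "C = vector [0, k]"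
  have AA: "A \<bullet> A = h * h" "B \<bullet> B = h * h" "C \<bullet> C = k * k" "A \<bullet> B = - (h * h)" "A \<bullet> C = 0" "B \<bullet> C = 0"
    by (simp_all add: ABC_def inner_real2)
  have "0 < 1 - h * h" "0 < 1 - k * k" using q2 k(2) ch q unfolding hh by simp_all
  then have pl: "A \<in> hplane" "B \<in> hplane" "C \<in> hplane"
    by (simp_all add: hplane_iff AA)
  have rh: "sqrt (1 - h * h) = 1 / cosh (z / 2)" by (simp add: hh real_sqrt_divide)
  have rk: "sqrt (1 - k * k) = 1 / q" using q by (simp add: k real_sqrt_divide)
  have "1 / (1 / cosh (z / 2) * (1 / q)) = cosh s" using ch by (simp add: q_def)
  then have AC: "hdist A C = s" "hdist B C = s"
    using assms by (simp_all add: hdist_def AA rh rk arcosh_cosh_real s_def)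
  have "(1 + h * h) / (1 / cosh (z / 2) * (1 / cosh (z / 2))) = (2 - (1 - h * h)) * (cosh (z / 2))\<^sup>2"
    by (simp add: power2_eq_square)
  also have "\<dots> = cosh z"
    unfolding hh using ch cosh_double_cosh[of "z / 2"] by (simp add: algebra_simps)
  finally have AB: "hdist A B = z"
    using assms by (simp add: hdist_def AA rh arcosh_cosh_real)
  have "cross2 A B C = 2 * h * k" by (simp add: cross2_def ABC_def)
  then have "\<not> collinear {A, B, C}" using h k cross2_eq_0_iff_collinear[of A B C] by simp
  then have "base_perimeter_triangle z P A B C"
    using pl AB AC by (simp add: base_perimeter_triangle_def htriangle_iff hperimeter_def
        hdist_commute[of C A] s_def)
  then show ?thesis using AC by metis
qed

text \<open>The assumptions are precisely the conditions for such triangles to exist: positive base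
  and strict triangle inequality. Congruence respects the order of the vertices, so base goes to
  base.\<close>

theorem lemma3p6:
  fixes z P :: real
  assumes "0 < z" and "2 * z < P"
  shows "\<exists>A B C. base_perimeter_triangle z P A B C \<and> hdist A C = hdist B C \<and>
    (\<forall>A' B' C'. base_perimeter_triangle z P A' B' C' \<longrightarrow>
       htriangle_area A' B' C' \<le> htriangle_area A B C \<and>
       (htriangle_area A' B' C' = htriangle_area A B C \<longleftrightarrow> hdist A' C' = hdist B' C') \<and>
       (htriangle_area A' B' C' = htriangle_area A B C \<longrightarrow> hcongruent A' B' C' A B C))"
proof -
  obtain A B C where T: "base_perimeter_triangle z P A B C" and iso: "hdist A C = hdist B C"
    using exists_isosceles_triangle[OF assms] by blast
  have area: "htriangle_area A B C = base_area z (P - z) 1"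
    using base_perimeter_triangle_area(1)[OF T assms(2)] iso by simp
  have "htriangle_area A' B' C' \<le> htriangle_area A B C \<and>
       (htriangle_area A' B' C' = htriangle_area A B C \<longleftrightarrow> hdist A' C' = hdist B' C') \<and>
       (htriangle_area A' B' C' = htriangle_area A B C \<longrightarrow> hcongruent A' B' C' A B C)"
    if T': "base_perimeter_triangle z P A' B' C'" for A' B' C'
  proof -
    define k where "k = cosh ((hdist B' C' - hdist A' C') / 2)"
    note area' = base_perimeter_triangle_area[OF T' assms(2), folded k_def]
    have less: "htriangle_area A' B' C' < htriangle_area A B C" if "hdist A' C' \<noteq> hdist B' C'"
    proof -
      \<comment> \<open>The hyperbolic cosine takes the value 1 only at 0.\<close>
      have "k \<noteq> 1" using that by (simp add: k_def)
      then have "1 < k" using cosh_real_ge_1 by (simp add: k_def less_le)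
      then show ?thesis unfolding area area'(1)
        using base_area_less assms area'(2) by simp
    qed
    have eq: "htriangle_area A' B' C' = htriangle_area A B C" if "hdist A' C' = hdist B' C'"
      using that by (simp add: area area'(1) k_def)
    have "hcongruent A' B' C' A B C" if "hdist A' C' = hdist B' C'"
    proof (rule hcongruent_if_sides_eq)
      show "htriangle A' B' C'" "htriangle A B C" "hdist A B = hdist A' B'"
        using T T' by (simp_all add: base_perimeter_triangle_def)
      \<comment> \<open>Equal legs must each have length \<open>(P - z) / 2\<close>, in both
        triangles.\<close>
      show "hdist B C = hdist B' C'" "hdist C A = hdist C' A'"
        using T T' iso that hdist_commute[of C A] hdist_commute[of C' A']
        by (simp_all add: base_perimeter_triangle_def hperimeter_def)
    qed
    then show ?thesis using less eq by fastforce
  qed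
  then show ?thesis using T iso by blast
qed

end
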